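(* Let $G$ be a discrete group acting without inversion on a tree $\mathcal{T}$, let $\mathcal{E}$ be the set of oriented edges of $\mathcal{T}$, and let $b\in Z^1(G,\ell^2(\mathcal{E}))$ be the Haagerup cocycle. Then the class $[b]$ is trivial in $\overline{H}^1(G,\ell^2(\mathcal{E}))$ if and only if the $G$-action on $\mathcal{T}$ is elementary.
   Context: For an oriented edge $h\in\mathcal E$ with initial vertex $h_-$ and terminal vertex $h_+$, and a vertex $x$ of $\mathcal T$, say that $h$ points towards $x$ if $d(x,h_+)<d(x,h_-)$. Let $\mathbf 1_x:\mathcal E\to\{0,1\}$ be the characteristic function of the set of oriented edges pointing towards $x$. Fixing a base vertex $x_0$, the Haagerup cocycle is $b(g)=\mathbf 1_{gx_0}-\mathbf 1_{x_0}$ ($g\in G$); it takes values in $\ell^2(\mathcal E)$ since $\|b(g)\|^2=2d(gx_0,x_0)$, it is a 1-cocycle for the permutation representation of $G$ on $\ell^2(\mathcal E)$, and its class in $H^1(G,\ell^2(\mathcal E))$ does not depend on $x_0$. The action of $G$ on $\mathcal T$ is elementary if $G$ has a finite orbit in $\mathcal T$ or in the boundary (space of ends) $\partial\mathcal T$. For a unitary $G$-module $M$, $\overline H^1(G,M)=Z^1(G,M)/\overline{B^1(G,M)}$, where the closure is for uniform convergence on compact subsets of $G$ (pointwise convergence here, as $G$ is discrete). *)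

theory Defs
  imports
    "HOL-Analysis.Analysis"
    "HOL-Library.Function_Algebras"
    "HOL-Algebra.Group_Action"
    "Graph_Theory.Digraph_Component"
    "Graph_Theory.Shortest_Path"
begin

section \<open>Trees\<close>

text \<open>
  A tree is a non-empty connected simple graph without cycles, given by its vertices and its
  oriented edges; an oriented edge is the pair of its initial and its terminal vertex, and
  \<open>parcs\<close> contains both orientations of every edge.  The predicate \<open>tree\<close> of
  \<open>Digraph_Component\<close> cannot be used: it counts the closed walk \<open>a, b, a\<close> as a cycle.
  Since there are no loops, bounding the length of cycles from below by 3 excludes exactly
  those walks.  \<open>Digraph_Component.connected\<close> includes non-emptiness.
\<close>

definition is_tree :: "'v pair_pre_digraph \<Rightarrow> bool" where
  "is_tree T \<longleftrightarrow>
     pair_bidirected_digraph T \<and>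
     Digraph_Component.connected (with_proj T) \<and>
     \<not> (\<exists>p. pre_digraph.cycle (with_proj T) p \<and> length p \<ge> 3)"

definition tree_dist :: "'v pair_pre_digraph \<Rightarrow> 'v \<Rightarrow> 'v \<Rightarrow> ereal" where
  "tree_dist T = wf_digraph.\<mu> (with_proj T) (\<lambda>_. 1)"

text \<open>
  Ends are classes of geodesic rays (in a tree: injective infinite paths) that coincide
  eventually up to a shift.
\<close>

definition rays :: "'v pair_pre_digraph \<Rightarrow> (nat \<Rightarrow> 'v) set" where
  "rays T = {r. inj r \<and> (\<forall>n. (r n, r (Suc n)) \<in> parcs T)}"

definition cofinal_rel :: "'v pair_pre_digraph \<Rightarrow> (nat \<Rightarrow> 'v) rel" where
  "cofinal_rel T = {(r, s). r \<in> rays T \<and> s \<in> rays T \<and> (\<exists>m n. \<forall>k. r (m + k) = s (n + k))}"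

definition ends :: "'v pair_pre_digraph \<Rightarrow> (nat \<Rightarrow> 'v) set set" where
  "ends T = rays T // cofinal_rel T"


section \<open>Group actions on trees\<close>

definition tree_action ::
  "('g, 'c) monoid_scheme \<Rightarrow> 'v pair_pre_digraph \<Rightarrow> ('g \<Rightarrow> 'v \<Rightarrow> 'v) \<Rightarrow> bool" where
  "tree_action G T \<phi> \<longleftrightarrow>
     group_action G (pverts T) \<phi> \<and>
     (\<forall>g\<in>carrier G. \<forall>(x, y)\<in>parcs T. (\<phi> g x, \<phi> g y) \<in> parcs T)"

definition without_inversion ::
  "('g, 'c) monoid_scheme \<Rightarrow> 'v pair_pre_digraph \<Rightarrow> ('g \<Rightarrow> 'v \<Rightarrow> 'v) \<Rightarrow> bool" where
  "without_inversion G T \<phi> \<longleftrightarrow>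
     \<not> (\<exists>g\<in>carrier G. \<exists>(x, y)\<in>parcs T. \<phi> g x = y \<and> \<phi> g y = x)"

definition end_action :: "('g \<Rightarrow> 'v \<Rightarrow> 'v) \<Rightarrow> 'g \<Rightarrow> (nat \<Rightarrow> 'v) set \<Rightarrow> (nat \<Rightarrow> 'v) set" where
  "end_action \<phi> g \<xi> = (\<lambda>r. \<phi> g \<circ> r) ` \<xi>"

definition elementary_action ::
  "('g, 'c) monoid_scheme \<Rightarrow> 'v pair_pre_digraph \<Rightarrow> ('g \<Rightarrow> 'v \<Rightarrow> 'v) \<Rightarrow> bool" where
  "elementary_action G T \<phi> \<longleftrightarrow>
     (\<exists>x\<in>pverts T. finite (orbit G \<phi> x)) \<or>
     (\<exists>\<xi>\<in>ends T. finite (orbit G (end_action \<phi>) \<xi>))"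


section \<open>The Hilbert space of square-summable functions\<close>

text \<open>Functions on \<open>E\<close> are represented by their extension by zero.\<close>

definition ell2 :: "'e set \<Rightarrow> ('e \<Rightarrow> complex) set" where
  "ell2 E = {f. (\<forall>e. e \<notin> E \<longrightarrow> f e = 0) \<and> (\<lambda>e. (cmod (f e))\<^sup>2) summable_on E}"

definition ell2_dist :: "'e set \<Rightarrow> ('e \<Rightarrow> complex) \<Rightarrow> ('e \<Rightarrow> complex) \<Rightarrow> real" where
  "ell2_dist E f f' = sqrt (\<Sum>\<^sub>\<infinity>e\<in>E. (cmod (f e - f' e))\<^sup>2)"

abbreviation ell2_topology :: "'e set \<Rightarrow> ('e \<Rightarrow> complex) topology" where
  "ell2_topology E \<equiv> Metric_space.mtopology (ell2 E) (ell2_dist E)"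

lemma ell2_diff_summable:
  assumes "f \<in> ell2 E" "g \<in> ell2 E"
  shows "(\<lambda>e. (cmod (f e - g e))\<^sup>2) summable_on E"
proof (rule summable_on_comparison_test)
  show "(\<lambda>e. 2 * (cmod (f e))\<^sup>2 + 2 * (cmod (g e))\<^sup>2) summable_on E"
    using assms by (intro summable_on_add summable_on_cmult_right) (auto simp: ell2_def)
  fix e
  have "(cmod (f e - g e))\<^sup>2 \<le> (cmod (f e) + cmod (g e))\<^sup>2"
    by (intro power_mono norm_triangle_ineq4) auto
  also have "\<dots> \<le> 2 * (cmod (f e))\<^sup>2 + 2 * (cmod (g e))\<^sup>2"
    using sum_squares_bound[of "cmod (f e)" "cmod (g e)"] by (simp add: power2_sum)
  finally show "(cmod (f e - g e))\<^sup>2 \<le> 2 * (cmod (f e))\<^sup>2 + 2 * (cmod (g e))\<^sup>2" .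
qed auto

lemma Metric_space_ell2: "Metric_space (ell2 E) (ell2_dist E)"
proof
  fix f g :: "'a \<Rightarrow> complex"
  show "0 \<le> ell2_dist E f g"
    by (simp add: ell2_dist_def infsum_nonneg)
  show "ell2_dist E f g = ell2_dist E g f"
    by (simp add: ell2_dist_def norm_minus_commute)
next
  fix f g :: "'a \<Rightarrow> complex"
  assume fg: "f \<in> ell2 E" "g \<in> ell2 E"
  show "ell2_dist E f g = 0 \<longleftrightarrow> f = g"
  proof
    assume "ell2_dist E f g = 0"
    then have *: "(\<Sum>\<^sub>\<infinity>e\<in>E. (cmod (f e - g e))\<^sup>2) \<le> 0"
      by (simp add: ell2_dist_def)
    have "f e = g e" for e
    proof (cases "e \<in> E")
      case True
      then show ?thesis
        using nonneg_infsum_le_0D[OF * ell2_diff_summable[OF fg], of e] by simp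
    next
      case False
      then show ?thesis using fg by (simp add: ell2_def)
    qed
    then show "f = g" by blast
  qed (simp add: ell2_dist_def)
next
  fix f g h :: "'a \<Rightarrow> complex"
  assume fgh: "f \<in> ell2 E" "g \<in> ell2 E" "h \<in> ell2 E"
  have fin: "L2_set (\<lambda>e. cmod (u e - v e)) F \<le> ell2_dist E u v"
    if "u \<in> ell2 E" "v \<in> ell2 E" "finite F" "F \<subseteq> E" for u v :: "'a \<Rightarrow> complex" and F
    unfolding L2_set_def ell2_dist_def
    using that by (intro real_sqrt_le_mono finite_sum_le_infsum ell2_diff_summable) auto
  have nonneg: "0 \<le> ell2_dist E u v" for u v :: "'a \<Rightarrow> complex"
    by (simp add: ell2_dist_def infsum_nonneg)
  have "(\<Sum>\<^sub>\<infinity>e\<in>E. (cmod (f e - h e))\<^sup>2) \<le> (ell2_dist E f g + ell2_dist E g h)\<^sup>2"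
  proof (rule infsum_le_finite_sums[OF ell2_diff_summable[OF fgh(1,3)]])
    fix F assume F: "finite F" "F \<subseteq> E"
    have "L2_set (\<lambda>e. cmod (f e - h e)) F
        \<le> L2_set (\<lambda>e. cmod (f e - g e) + cmod (g e - h e)) F"
      by (intro L2_set_mono) (auto simp: dist_norm[symmetric] dist_triangle)
    also have "\<dots> \<le> L2_set (\<lambda>e. cmod (f e - g e)) F + L2_set (\<lambda>e. cmod (g e - h e)) F"
      by (rule L2_set_triangle_ineq)
    also have "\<dots> \<le> ell2_dist E f g + ell2_dist E g h"
      using fgh F by (intro add_mono fin)
    finally show "(\<Sum>e\<in>F. (cmod (f e - h e))\<^sup>2) \<le> (ell2_dist E f g + ell2_dist E g h)\<^sup>2"
      unfolding L2_set_def by (rule sqrt_le_D)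
  qed
  then show "ell2_dist E f h \<le> ell2_dist E f g + ell2_dist E g h"
    unfolding ell2_dist_def[of E f h] using nonneg by (intro real_le_lsqrt) auto
qed

definition perm_rep ::
  "('g, 'c) monoid_scheme \<Rightarrow> 'e set \<Rightarrow> ('g \<Rightarrow> 'e \<Rightarrow> 'e) \<Rightarrow> 'g \<Rightarrow> ('e \<Rightarrow> complex) \<Rightarrow> 'e \<Rightarrow> complex" where
  "perm_rep G E \<psi> g f = (\<lambda>e. if e \<in> E then f (\<psi> (inv\<^bsub>G\<^esub> g) e) else 0)"


section \<open>Reduced first cohomology\<close>

text \<open>
  \<open>M\<close> is the underlying set of the module and \<open>\<pi>\<close> the representation.  Cochains on \<open>G\<close> are
  functions that are \<open>undefined\<close> outside \<open>carrier G\<close>, as in \<open>product_topology\<close>; for a discrete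
  group, uniform convergence on compact sets is convergence in the product topology.
\<close>

definition cocycles :: "('g, 'c) monoid_scheme \<Rightarrow> 'm::ab_group_add set \<Rightarrow> ('g \<Rightarrow> 'm \<Rightarrow> 'm) \<Rightarrow> ('g \<Rightarrow> 'm) set" where
  "cocycles G M \<pi> =
     {c \<in> carrier G \<rightarrow>\<^sub>E M. \<forall>g\<in>carrier G. \<forall>h\<in>carrier G. c (g \<otimes>\<^bsub>G\<^esub> h) = c g + \<pi> g (c h)}"

definition coboundaries :: "('g, 'c) monoid_scheme \<Rightarrow> 'm::ab_group_add set \<Rightarrow> ('g \<Rightarrow> 'm \<Rightarrow> 'm) \<Rightarrow> ('g \<Rightarrow> 'm) set" where
  "coboundaries G M \<pi> = {\<lambda>g\<in>carrier G. \<pi> g v - v | v. v \<in> M}"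

definition cocycle_group :: "('g, 'c) monoid_scheme \<Rightarrow> 'm::ab_group_add set \<Rightarrow> ('g \<Rightarrow> 'm \<Rightarrow> 'm) \<Rightarrow> ('g \<Rightarrow> 'm) monoid" where
  "cocycle_group G M \<pi> =
     \<lparr>carrier = cocycles G M \<pi>,
      mult = (\<lambda>c d. \<lambda>g\<in>carrier G. c g + d g),
      one = (\<lambda>g\<in>carrier G. 0)\<rparr>"

definition closed_coboundaries ::
  "('g, 'c) monoid_scheme \<Rightarrow> 'm::ab_group_add set \<Rightarrow> 'm topology \<Rightarrow> ('g \<Rightarrow> 'm \<Rightarrow> 'm) \<Rightarrow> ('g \<Rightarrow> 'm) set" where
  "closed_coboundaries G M X \<pi> =
     subtopology (product_topology (\<lambda>_. X) (carrier G)) (cocycles G M \<pi>)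
       closure_of coboundaries G M \<pi>"

definition reduced_H1 ::
  "('g, 'c) monoid_scheme \<Rightarrow> 'm::ab_group_add set \<Rightarrow> 'm topology \<Rightarrow> ('g \<Rightarrow> 'm \<Rightarrow> 'm) \<Rightarrow> ('g \<Rightarrow> 'm) set monoid" where
  "reduced_H1 G M X \<pi> = cocycle_group G M \<pi> Mod closed_coboundaries G M X \<pi>"

definition reduced_class ::
  "('g, 'c) monoid_scheme \<Rightarrow> 'm::ab_group_add set \<Rightarrow> 'm topology \<Rightarrow> ('g \<Rightarrow> 'm \<Rightarrow> 'm) \<Rightarrow> ('g \<Rightarrow> 'm) \<Rightarrow> ('g \<Rightarrow> 'm) set" where
  "reduced_class G M X \<pi> c = closed_coboundaries G M X \<pi> #>\<^bsub>cocycle_group G M \<pi>\<^esub> c"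


section \<open>The Haagerup cocycle\<close>

definition edge_action :: "('g \<Rightarrow> 'v \<Rightarrow> 'v) \<Rightarrow> 'g \<Rightarrow> 'v \<times> 'v \<Rightarrow> 'v \<times> 'v" where
  "edge_action \<phi> g = map_prod (\<phi> g) (\<phi> g)"

definition points_towards :: "'v pair_pre_digraph \<Rightarrow> 'v \<times> 'v \<Rightarrow> 'v \<Rightarrow> bool" where
  "points_towards T h x \<longleftrightarrow> tree_dist T x (snd h) < tree_dist T x (fst h)"

definition towards_indicator :: "'v pair_pre_digraph \<Rightarrow> 'v \<Rightarrow> 'v \<times> 'v \<Rightarrow> complex" where
  "towards_indicator T x = indicator {h \<in> parcs T. points_towards T h x}"

definition haagerup_cocycle ::
  "('g, 'c) monoid_scheme \<Rightarrow> 'v pair_pre_digraph \<Rightarrow> ('g \<Rightarrow> 'v \<Rightarrow> 'v) \<Rightarrow> 'v \<Rightarrow> 'g \<Rightarrow> 'v \<times> 'v \<Rightarrow> complex" where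
  "haagerup_cocycle G T \<phi> x\<^sub>0 =
     (\<lambda>g\<in>carrier G. towards_indicator T (\<phi> g x\<^sub>0) - towards_indicator T x\<^sub>0)"

end

theory Submission
  imports Defs "HOL-Real_Asymp.Real_Asymp"
begin

text \<open>
  Suppose that the class of the Haagerup cocycle is trivial.  If \<open>ell2\<close> of the edges has no almost
  invariant vectors, then the coboundaries that approximate the cocycle come from vectors of bounded
  norm, so the cocycle is bounded, and so are the orbits, because \<open>b g\<close> has squared norm twice the
  distance from \<open>g x\<close> to \<open>x\<close>; the centre of a bounded orbit is a finite invariant set.
  Otherwise a cluster point of the densities of almost invariant vectors is an invariant finitely
  additive mean on the vertices, and following half trees of mass at least 1/2 leads to a finite
  invariant set of vertices or of ends.

  Conversely, a finite invariant set of vertices or ends provides almost equivariant averages of the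
  functions \<open>ind y\<close>, with \<open>y\<close> far out on rays to the ends; \<open>ind x\<close> minus such an average is a
  square-summable function whose coboundary approximates the cocycle.
\<close>

section \<open>Trees\<close>

text \<open>Vertices may have infinite degree. A bounded orbit can therefore be infinite and is
  replaced by its centre, and an invariant mean may vanish on every finite set; it is located only
  through the masses of the half trees on the two sides of an edge. These add up to 1, whence the
  threshold 1/2: every edge is heavy in at least one orientation, and mass exactly 1/2 on both sides
  is the one ambiguous case, responsible for dead ends and for branching of heavy rays. Conversely,
  for a fixed end no single \<open>ind y\<close> need be almost invariant: an element that shifts a
  ray by t moves \<open>ind y\<close> by norm sqrt (2 t), however far out y lies. Averaging over N
  consecutive vertices helps because the shift changes the sum by t differences
  \<open>ind p - ind q\<close> with p and q at distance at most N, hence of norm at most sqrt (2 N).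
  After division by N the error is of order t * sqrt (2 / N); it is the square root in the norm of
  \<open>ind p - ind q\<close> that makes it tend to 0.\<close>

locale tree_graph =
  fixes T :: "'v pair_pre_digraph"
  assumes tree: "is_tree T"
begin

abbreviation V where "V \<equiv> pverts T"
abbreviation E where "E \<equiv> parcs T"

text \<open>Powers of the arc relation admit induction on the number of steps and give values in the
  natural numbers; \<open>tree_dist_eq\<close> links them to the extended real distance of the
  definitions.\<close>

definition vd :: "'v \<Rightarrow> 'v \<Rightarrow> nat" where
  "vd x y = (LEAST n. (x, y) \<in> E ^^ n)"

lemma bidirected: "pair_bidirected_digraph T"
  using tree by (simp add: is_tree_def)

sublocale pair_bidirected_digraph T by (rule bidirected)

lemma edge_sym: "(x, y) \<in> E \<Longrightarrow> (y, x) \<in> E"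
  using pair_sym_arcs by (auto simp: symmetric_def dest: symD)

lemma edge_V: "(x, y) \<in> E \<Longrightarrow> x \<in> V" "(x, y) \<in> E \<Longrightarrow> y \<in> V"
  by (auto dest: wellformed')

lemma edge_neq: "(x, y) \<in> E \<Longrightarrow> x \<noteq> y"
  using pair_no_loops by force

lemma sym_relpow: "(x, y) \<in> E ^^ n \<Longrightarrow> (y, x) \<in> E ^^ n"
proof (induction n arbitrary: y)
  case (Suc n)
  then obtain z where "(x, z) \<in> E ^^ n" "(z, y) \<in> E" by auto
  then show ?case using Suc.IH relpow_Suc_I2 edge_sym by metis
qed auto

lemma relpow_exists:
  assumes "x \<in> V" "y \<in> V" shows "\<exists>n. (x, y) \<in> E ^^ n"
proof -
  have "Digraph_Component.connected (with_proj T)" using tree by (simp add: is_tree_def)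
  then have "x \<rightarrow>\<^sup>*\<^bsub>with_proj (mk_symmetric (with_proj T))\<^esub> y"
    using assms unfolding Digraph_Component.connected_def strongly_connected_def
    by (auto simp: mk_symmetric_def)
  \<comment> \<open>\<open>connected\<close> speaks of the symmetrised digraph, which has the same
    arcs because both orientations are already present.\<close>
  moreover have "parcs (mk_symmetric (with_proj T)) = E"
    unfolding mk_symmetric_def using edge_sym by auto
  ultimately have "(x, y) \<in> rtrancl_on (pverts (mk_symmetric (with_proj T))) E"
    by (simp add: reachable_def)
  then have "(x, y) \<in> E\<^sup>*"
    by (rule rtrancl_on_rtranclI)
  then show ?thesis by (rule rtrancl_imp_relpow)
qed

lemma vd_relpow: "\<lbrakk>x \<in> V; y \<in> V\<rbrakk> \<Longrightarrow> (x, y) \<in> E ^^ vd x y"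
  unfolding vd_def using relpow_exists by (rule LeastI_ex)

lemma vd_le: "(x, y) \<in> E ^^ n \<Longrightarrow> vd x y \<le> n"
  unfolding vd_def by (rule Least_le)

lemma vd_sym: "vd x y = vd y x"
  unfolding vd_def by (metis sym_relpow)

lemma vd_self [simp]: "vd x x = 0"
  using vd_le[of x x 0] by simp

lemma vd_zero: "\<lbrakk>x \<in> V; y \<in> V\<rbrakk> \<Longrightarrow> vd x y = 0 \<longleftrightarrow> x = y"
  using vd_relpow[of x y] by auto

lemma vd_triangle: "\<lbrakk>x \<in> V; y \<in> V; z \<in> V\<rbrakk> \<Longrightarrow> vd x z \<le> vd x y + vd y z"
  by (metis vd_le vd_relpow relpow_add relcompI)

lemma vd_edge: "(x, y) \<in> E \<Longrightarrow> vd x y = 1"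
  by (metis One_nat_def edge_V edge_neq le_0_eq le_SucE relpow_1 vd_le vd_zero)

lemma closer_exists:
  assumes "x \<in> V" "y \<in> V" "x \<noteq> y"
  obtains z where "(y, z) \<in> E" "vd x y = Suc (vd x z)"
proof -
  obtain n where n: "vd x y = Suc n" using vd_zero[OF assms(1,2)] assms(3) by (cases "vd x y") auto
  with vd_relpow[OF assms(1,2)] obtain z where z: "(x, z) \<in> E ^^ n" "(z, y) \<in> E" by auto
  have "vd x y \<le> vd x z + vd z y" using assms z edge_V by (intro vd_triangle) blast+
  with vd_le[OF z(1)] n vd_edge[OF z(2)] have "vd x y = Suc (vd x z)" by linarith
  with z that edge_sym show thesis by blast
qed

lemma tree_dist_eq:
  assumes "x \<in> V" "y \<in> V" shows "tree_dist T x y = ereal (real (vd x y))"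
proof -
  have rel: "(x, y) \<in> E ^^ n" if "awalk x p y" "length p = n" for p n x
    using that
  proof (induction p arbitrary: x n)
    case (Cons a p)
    then have "awalk (snd a) p y" "fst a = x" "a \<in> E" by (auto simp: awalk_Cons_iff)
    with Cons show ?case by (metis length_Cons prod.collapse relpow_Suc_I2)
  qed (auto simp: awalk_Nil_iff)
  have walk: "\<exists>p. awalk x p y \<and> length p = n" if "(x, y) \<in> E ^^ n" for n
    using that assms(1)
  proof (induction n arbitrary: x)
    case 0 then show ?case by (auto simp: awalk_Nil_iff)
  next
    case (Suc n)
    then obtain z where z: "(x, z) \<in> E" "(z, y) \<in> E ^^ n" by (meson relpow_Suc_E2)
    with Suc.IH edge_V obtain p where "awalk z p y" "length p = n" by blast
    with z show ?case by (intro exI[of _ "(x,z) # p"]) (auto simp: awalk_Cons_iff dest: edge_V)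
  qed
  have cost: "awalk_cost (\<lambda>_. 1) p = real (length p)" for p :: "('v \<times> 'v) list"
    by (induction p) auto
  show ?thesis
    unfolding tree_dist_def \<mu>_def cost
  proof (rule antisym)
    obtain p where "awalk x p y" "length p = vd x y" using walk vd_relpow assms by blast
    then show "(INF p\<in>{p. awalk x p y}. ereal (real (length p))) \<le> ereal (real (vd x y))"
      by (intro INF_lower2[of p]) auto
    show "ereal (real (vd x y)) \<le> (INF p\<in>{p. awalk x p y}. ereal (real (length p)))"
      by (intro INF_greatest) (auto intro: vd_le rel)
  qed
qed

section \<open>Consequences of acyclicity for distances\<close>

lemma no_cycle:
  assumes "distinct vs" "length vs \<ge> 3" "successively (\<lambda>a b. (a, b) \<in> E) vs" "(last vs, hd vs) \<in> E"
  shows False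
proof -
  have walk: "awalk (hd vs) (zip vs (tl vs)) (last vs) \<and> awalk_verts (hd vs) (zip vs (tl vs)) = vs"
    if "vs \<noteq> []" "successively (\<lambda>a b. (a, b) \<in> E) vs" "hd vs \<in> V" for vs
    using that
  proof (induction vs rule: induct_list012)
    case (3 a b ws)
    then show ?case by (auto simp: awalk_Cons_iff dest: edge_V)
  qed (auto simp: awalk_Nil_iff)
  have ne: "vs \<noteq> []" using assms(2) by auto
  let ?p = "zip vs (tl vs)"
  have w: "awalk (hd vs) ?p (last vs)" "awalk_verts (hd vs) ?p = vs"
    using walk[OF ne assms(3)] edge_V assms(4) by auto
  have "awalk (last vs) ((last vs, hd vs) # ?p) (last vs)"
    using w assms(4) edge_V by (auto simp: awalk_Cons_iff)
  moreover have "distinct (tl (awalk_verts (last vs) ((last vs, hd vs) # ?p)))"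
    using w(2) assms(1) by simp
  ultimately have "cycle ((last vs, hd vs) # ?p)"
    unfolding cycle_def by blast
  moreover have "length ((last vs, hd vs) # ?p) \<ge> 3" using assms(2) by simp
  ultimately show False using tree unfolding is_tree_def by blast
qed

text \<open>Descending from \<open>u\<close> and \<open>w\<close> towards \<open>x\<close> at equal
  speed, the two branches meet at \<open>x\<close> at the latest. The two end points lie on the
  outermost level, so adding them to the inner path keeps it distinct. The path stays in the ball of
  radius \<open>n\<close>, ready to be closed to a cycle by an edge between \<open>u\<close> and
  \<open>w\<close> or by a common neighbour further out.\<close>

lemma inner_path:
  assumes "x \<in> V" "u \<in> V" "w \<in> V" "u \<noteq> w" "vd x u = n" "vd x w = n"
  obtains vs where "distinct vs" "length vs \<ge> 3" "hd vs = u" "last vs = w"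
    "successively (\<lambda>a b. (a, b) \<in> E) vs" "\<And>v. v \<in> set vs \<Longrightarrow> vd x v \<le> n"
proof -
  have "\<exists>vs. distinct vs \<and> length vs \<ge> 3 \<and> hd vs = u \<and> last vs = w \<and>
    successively (\<lambda>a b. (a, b) \<in> E) vs \<and> (\<forall>v \<in> set vs. vd x v \<le> n)"
    using assms(2-)
  proof (induction n arbitrary: u w)
    case 0
    then show ?case using vd_zero assms(1) by metis
  next
    case (Suc n)
    have "x \<noteq> u" "x \<noteq> w" using Suc.prems by auto
    then obtain u' w' where u': "(u, u') \<in> E" "vd x u = Suc (vd x u')"
      and w': "(w, w') \<in> E" "vd x w = Suc (vd x w')"
      using closer_exists assms(1) Suc.prems by metis
    show ?case
    proof (cases "u' = w'")
      case True
      have "vd x u' = n" using u' Suc.prems by simp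
      moreover have "u \<noteq> u'" "w \<noteq> u'" using u' w' True by auto
      moreover have "(u', w) \<in> E" using w' True edge_sym by blast
      ultimately show ?thesis using u' Suc.prems
        by (intro exI[of _ "[u, u', w]"]) auto
    next
      case False
      have "\<exists>vs. distinct vs \<and> length vs \<ge> 3 \<and> hd vs = u' \<and> last vs = w' \<and>
          successively (\<lambda>a b. (a, b) \<in> E) vs \<and> (\<forall>v \<in> set vs. vd x v \<le> n)"
        using False u' w' Suc.prems edge_V by (intro Suc.IH) auto
      then obtain vs where vs: "distinct vs" "length vs \<ge> 3" "hd vs = u'" "last vs = w'"
          "successively (\<lambda>a b. (a, b) \<in> E) vs" "\<And>v. v \<in> set vs \<Longrightarrow> vd x v \<le> n"
        by blast
      have "u \<notin> set vs" "w \<notin> set vs" using vs(6) Suc.prems by fastforce+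
      moreover have "successively (\<lambda>a b. (a, b) \<in> E) (u # vs @ [w])"
        using vs u' w' edge_sym by (auto simp: successively_append_iff successively_Cons hd_append)
      ultimately show ?thesis using vs Suc.prems
        by (intro exI[of _ "u # vs @ [w]"]) (auto intro: le_SucI)
    qed
  qed
  then show thesis using that by blast
qed

text \<open>A tree is bipartite: an edge inside one level would close the path of
  \<open>inner_path\<close> to a cycle.\<close>

lemma vd_edge_neq:
  assumes "x \<in> V" "(u, w) \<in> E" shows "vd x u \<noteq> vd x w"
proof
  assume eq: "vd x u = vd x w"
  obtain vs where "distinct vs" "length vs \<ge> 3" "hd vs = u" "last vs = w"
    "successively (\<lambda>a b. (a, b) \<in> E) vs"
    using inner_path[OF assms(1), of u w] assms edge_V edge_neq eq by metis
  then show False using no_cycle[of vs] assms edge_sym by blast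
qed

lemma vd_edge_cases:
  assumes "x \<in> V" "(u, w) \<in> E"
  shows "vd x u = Suc (vd x w) \<or> vd x w = Suc (vd x u)"
proof -
  have "vd x u \<le> vd x w + vd w u" "vd x w \<le> vd x u + vd u w"
    using assms edge_V by (blast intro: vd_triangle)+
  moreover have "vd u w = 1" "vd w u = 1" using assms edge_sym vd_edge by blast+
  ultimately show ?thesis using vd_edge_neq[OF assms] by linarith
qed

text \<open>Geodesics to \<open>x\<close> are unique: two such neighbours would be joined inside a
  ball that omits \<open>y\<close>, and \<open>y\<close> would close a cycle.\<close>

lemma closer_unique:
  assumes "x \<in> V" "(y, u) \<in> E" "(y, w) \<in> E" "vd x u < vd x y" "vd x w < vd x y"
  shows "u = w"
proof (rule ccontr)
  assume "u \<noteq> w"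
  have lev: "vd x y = Suc (vd x u)" "vd x y = Suc (vd x w)"
    using vd_edge_cases[OF assms(1,2)] vd_edge_cases[OF assms(1,3)] assms by linarith+
  obtain vs where vs: "distinct vs" "length vs \<ge> 3" "hd vs = u" "last vs = w"
    "successively (\<lambda>a b. (a, b) \<in> E) vs" "\<And>v. v \<in> set vs \<Longrightarrow> vd x v \<le> vd x u"
    using inner_path[OF assms(1), of u w "vd x u"] assms edge_V \<open>u \<noteq> w\<close> lev by (metis Suc_inject)
  have "y \<notin> set vs" using vs(6) assms(4) by fastforce
  moreover have "successively (\<lambda>a b. (a, b) \<in> E) (y # vs)"
    using vs assms by (simp add: successively_Cons)
  moreover have "last (y # vs) = w" using vs by auto
  ultimately show False
    using no_cycle[of "y # vs"] vs edge_sym[OF assms(3)] by simp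
qed

subsection \<open>Half trees\<close>

text \<open>For an edge, this is the component of \<open>y\<close> after its removal, expressed by
  distances; \<open>p\<close> belongs to it exactly when the edge points towards
  \<open>p\<close>.\<close>

definition half :: "'v \<Rightarrow> 'v \<Rightarrow> 'v set" where
  "half x y = {p \<in> V. vd p y < vd p x}"

lemma half_V: "half x y \<subseteq> V"
  by (auto simp: half_def)

lemma not_half: "\<lbrakk>(x, y) \<in> E; p \<in> V\<rbrakk> \<Longrightarrow> p \<notin> half x y \<longleftrightarrow> p \<in> half y x"
  using vd_edge_cases[of p x y] by (auto simp: half_def)

lemma half_Suc: "\<lbrakk>(x, y) \<in> E; p \<in> half x y\<rbrakk> \<Longrightarrow> vd p x = Suc (vd p y)"
  using vd_edge_cases[of p x y] by (auto simp: half_def)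

lemma half_compl: "(x, y) \<in> E \<Longrightarrow> V - half x y = half y x"
  using not_half half_V by blast

lemma end_in_half: "(x, y) \<in> E \<Longrightarrow> y \<in> half x y"
  using edge_V vd_edge edge_sym by (simp add: half_def)

lemma half_disjoint:
  assumes "(x, y) \<in> E" "(x, z) \<in> E" "y \<noteq> z" shows "half x y \<inter> half x z = {}"
  using closer_unique[of _ x y z] assms by (auto simp: half_def)

lemma closer_half:
  assumes "p \<in> V" "x \<in> V" "p \<noteq> x" obtains y where "(x, y) \<in> E" "p \<in> half x y"
proof -
  obtain y where "(x, y) \<in> E" "vd p x = Suc (vd p y)" using closer_exists[OF assms] by blast
  with assms(1) show thesis by (intro that[of y]) (simp_all add: half_def)
qed

text \<open>This justifies the reading of \<open>half\<close> as a component. If \<open>u\<close>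
  were not \<open>x\<close>, its neighbour nearer to \<open>x\<close> and the vertex
  \<open>w\<close> would both be nearer to \<open>y\<close> than \<open>u\<close>, hence equal,
  although \<open>w\<close> is farther from \<open>x\<close> than \<open>u\<close>.\<close>

lemma half_crossing:
  assumes "(x, y) \<in> E" "(u, w) \<in> E" "u \<notin> half x y" "w \<in> half x y"
  shows "u = x \<and> w = y"
proof -
  have *: "u = x" if xy: "(x, y) \<in> E" and uw: "(u, w) \<in> E" and u: "u \<in> half y x" and w: "w \<in> half x y"
    for x y u w
  proof (rule ccontr)
    assume "u \<noteq> x"
    have V: "u \<in> V" "w \<in> V" "x \<in> V" "y \<in> V" using edge_V uw xy by blast+
    obtain u' where u': "(u, u') \<in> E" "vd x u = Suc (vd x u')"
      using closer_exists[of x u] V \<open>u \<noteq> x\<close> by metis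
    have d: "vd u y = Suc (vd u x)" "vd w x = Suc (vd w y)"
      using half_Suc u w xy edge_sym by blast+
    have c: "vd x u = Suc (vd x w) \<or> vd x w = Suc (vd x u)" "vd y u = Suc (vd y w) \<or> vd y w = Suc (vd y u)"
      using vd_edge_cases V uw by blast+
    have lev: "vd y w < vd y u" "vd x w > vd x u"
      using c d vd_sym[of u x] vd_sym[of u y] vd_sym[of w x] vd_sym[of w y] by linarith+
    have "vd y u' \<le> vd y x + vd x u'" using V u' edge_V by (blast intro: vd_triangle)
    then have "vd y u' < vd y u"
      using vd_edge[OF edge_sym[OF xy]] u'(2) d by (simp add: vd_sym)
    then have "u' = w" using closer_unique[of y u u' w] V u' uw lev by blast
    with u' lev show False by simp
  qed
  have "u \<in> half y x" using assms not_half edge_V by blast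
  then show ?thesis using *[OF assms(1,2)] *[OF edge_sym[OF assms(1)] edge_sym[OF assms(2)]] assms by blast
qed

text \<open>A geodesic from \<open>p\<close> to \<open>q\<close> has to cross the cut, and by
  \<open>half_crossing\<close> it does so along the edge from \<open>y\<close> to \<open>x\<close>.
  The induction follows it from \<open>p\<close> until that happens.\<close>

lemma half_gate:
  assumes "(x, y) \<in> E" "p \<in> half x y" "q \<in> half y x"
  shows "vd p q = Suc (vd p y + vd x q)"
proof (rule antisym)
  have V: "p \<in> V" "q \<in> V" "x \<in> V" "y \<in> V" using assms half_V edge_V by blast+
  show "vd p q \<le> Suc (vd p y + vd x q)"
    using vd_triangle[of p y q] vd_triangle[of y x q] V vd_edge[OF edge_sym[OF assms(1)]] by simp
  show "Suc (vd p y + vd x q) \<le> vd p q"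
    using assms(2) V(1)
  proof (induction "vd p q" arbitrary: p rule: less_induct)
    case less
    have "p \<noteq> q" using less.prems assms(3) not_half[OF assms(1)] V by blast
    then obtain p' where p': "(p, p') \<in> E" "vd q p = Suc (vd q p')"
      using closer_exists[of q p] V less.prems by metis
    show ?case
    proof (cases "p' \<in> half x y")
      case True
      then have "Suc (vd p' y + vd x q) \<le> vd p' q"
        using p' by (intro less.hyps) (auto simp: vd_sym dest: edge_V)
      moreover have "vd p y \<le> vd p p' + vd p' y" using less.prems p' V edge_V by (blast intro: vd_triangle)
      ultimately show ?thesis using p' vd_edge[OF p'(1)] by (simp add: vd_sym)
    next
      case False
      then have "p' = x \<and> p = y" using half_crossing[OF assms(1) edge_sym[OF p'(1)]] less.prems by blast
      then show ?thesis using p' by (simp add: vd_sym)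
    qed
  qed
qed

text \<open>Every geodesic from \<open>x'\<close> to a vertex behind the first edge passes through
  \<open>x\<close>; the edge at \<open>x'\<close> that starts towards \<open>x\<close> therefore
  starts towards all of these vertices.\<close>

lemma half_cover:
  assumes "(x, y) \<in> E" "x' \<in> half x y" "(x', y') \<in> E" "x \<in> half x' y'"
  shows "half y x \<subseteq> half x' y'"
proof
  fix p assume p: "p \<in> half y x"
  have V: "p \<in> V" "x \<in> V" "y \<in> V" "x' \<in> V" "y' \<in> V" using assms half_V edge_V p by blast+
  have "x \<in> half y x" using end_in_half assms(1) edge_sym by blast
  then have "vd x' p = Suc (vd x' y + vd x p)" "vd x' x = Suc (vd x' y)"
    using half_gate[OF assms(1,2)] p by auto
  moreover have "vd y' p \<le> vd y' x + vd x p" using V by (intro vd_triangle)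
  moreover have "vd y' x < vd x' x" using assms(4) by (simp add: half_def vd_sym)
  ultimately show "p \<in> half x' y'" using V by (simp add: half_def vd_sym[of p])
qed

lemma half_step:
  assumes "(x, y) \<in> E" "(y, z) \<in> E" "z \<noteq> x" shows "half y z \<subseteq> half x y"
  using half_disjoint[OF edge_sym[OF assms(1)] assms(2)] assms half_compl half_V by blast

text \<open>One step from \<open>p\<close> towards \<open>q\<close> removes exactly one edge from
  the separating set, the one just traversed. Each geometric edge occurs in one orientation only,
  the one pointing towards \<open>p\<close>.\<close>

lemma separating_edges:
  assumes "p \<in> V" "q \<in> V"
  shows "finite {h \<in> E. p \<in> half (fst h) (snd h) \<and> q \<notin> half (fst h) (snd h)}
    \<and> card {h \<in> E. p \<in> half (fst h) (snd h) \<and> q \<notin> half (fst h) (snd h)} = vd p q"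
  using assms
proof (induction "vd p q" arbitrary: p)
  case 0
  then have "p = q" using vd_zero by simp
  then have "{h \<in> E. p \<in> half (fst h) (snd h) \<and> q \<notin> half (fst h) (snd h)} = {}" by blast
  with 0 show ?case by (metis card.empty finite.emptyI)
next
  case (Suc n)
  let ?S = "\<lambda>p. {h \<in> E. p \<in> half (fst h) (snd h) \<and> q \<notin> half (fst h) (snd h)}"
  have "p \<noteq> q" using Suc.hyps(2) by auto
  then obtain p' where p': "(p, p') \<in> E" "vd q p = Suc (vd q p')"
    using closer_exists[of q p] Suc.prems by metis
  have V: "p' \<in> V" using p' edge_V by blast
  have IH: "finite (?S p') \<and> card (?S p') = vd p' q"
    using Suc.hyps Suc.prems p' V by (intro Suc.hyps(1)) (simp_all add: vd_sym)
  have q: "q \<notin> half p' p" "q \<in> half p p'" using p' Suc.prems by (auto simp: half_def)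
  have new: "(p', p) \<notin> ?S p'" by (auto simp: half_def)
  have "?S p = insert (p', p) (?S p')"
  proof (intro equalityI subsetI)
    fix h assume h: "h \<in> ?S p"
    then have "p' \<in> half (fst h) (snd h) \<or> h = (p', p)"
      using half_crossing[of "fst h" "snd h" p' p] p' edge_sym by (metis (no_types, lifting) mem_Collect_eq prod.collapse)
    with h show "h \<in> insert (p', p) (?S p')" by blast
  next
    fix h assume "h \<in> insert (p', p) (?S p')"
    then consider "h = (p', p)" | "h \<in> ?S p'" by blast
    then show "h \<in> ?S p"
    proof cases
      case 1
      then show ?thesis using p' q end_in_half edge_sym by auto
    next
      case 2
      have "p \<in> half (fst h) (snd h)"
      proof (rule ccontr)
        assume "p \<notin> half (fst h) (snd h)"
        then have "h = (p, p')"
          using half_crossing[of "fst h" "snd h" p p'] p' 2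
          by (metis (no_types, lifting) mem_Collect_eq prod.collapse)
        with 2 q show False by simp
      qed
      with 2 show ?thesis by blast
    qed
  qed
  with IH new p' show ?case by (simp add: vd_sym)
qed

subsection \<open>Rays and centres\<close>

text \<open>Seen from \<open>r m\<close>, every later vertex has a single nearer neighbour, its
  predecessor, so without backtracking the distance can only grow. Two consecutive distances are
  carried through the induction in order to know that the predecessor is the nearer one.\<close>

lemma nonbacktracking_vd:
  assumes "\<And>n. (r n, r (Suc n)) \<in> E" "\<And>n. r (Suc (Suc n)) \<noteq> r n"
  shows "vd (r m) (r (m + k)) = k"
proof -
  have V: "r n \<in> V" for n using assms(1) edge_V by blast
  have "vd (r m) (r (m + k)) = k \<and> vd (r m) (r (Suc (m + k))) = Suc k"
  proof (induction k)
    case 0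
    then show ?case using vd_edge assms(1) by simp
  next
    case (Suc k)
    let ?n = "m + k"
    have "\<not> vd (r m) (r (Suc (Suc ?n))) < vd (r m) (r (Suc ?n))"
      using closer_unique[OF V edge_sym[OF assms(1)] assms(1), of m ?n] assms(2)[of ?n] Suc by auto
    then show ?case using vd_edge_cases[OF V assms(1), of m "Suc ?n"] Suc by auto
  qed
  then show ?thesis ..
qed

lemma nonbacktracking_ray:
  assumes "\<And>n. (r n, r (Suc n)) \<in> E" "\<And>n. r (Suc (Suc n)) \<noteq> r n"
  shows "r \<in> rays T"
proof -
  have "r m \<noteq> r (m + Suc k)" for m k
    using nonbacktracking_vd[where r = r, OF assms, of m "Suc k"] by (metis nat.distinct(1) vd_self)
  then have "r m \<noteq> r n" if "m < n" for m n
    using less_imp_Suc_add[OF that] by force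
  then have "inj r" by (metis injI linorder_neqE_nat)
  with assms(1) show ?thesis by (simp add: rays_def)
qed

lemma ray_vd:
  assumes "r \<in> rays T" shows "vd (r m) (r (m + k)) = k"
proof (rule nonbacktracking_vd)
  show "r (Suc (Suc n)) \<noteq> r n" for n using assms by (simp add: rays_def inj_eq)
qed (use assms in \<open>simp add: rays_def\<close>)

lemma ray_V: "r \<in> rays T \<Longrightarrow> r n \<in> V"
  using edge_V(1)[of "r n" "r (Suc n)"] by (simp add: rays_def)

text \<open>\<open>R\<close> is the circumradius. If two centres \<open>x\<close> and
  \<open>y\<close> were not adjacent, the neighbour \<open>z\<close> of \<open>x\<close> on the way
  to \<open>y\<close> would be within \<open>R - 1\<close> of all of \<open>A\<close>: points beyond
  \<open>z\<close> are nearer to \<open>z\<close> than to \<open>x\<close>, and geodesics from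
  \<open>y\<close> to the other points pass through \<open>z\<close>. Since a tree has no triangles,
  there are at most two centres.\<close>

lemma finite_centre:
  assumes "A \<subseteq> V" "A \<noteq> {}" and bounded: "\<And>p q. \<lbrakk>p \<in> A; q \<in> A\<rbrakk> \<Longrightarrow> vd p q \<le> B"
  obtains R where "{x \<in> V. \<forall>p\<in>A. vd x p \<le> R} \<noteq> {}" "finite {x \<in> V. \<forall>p\<in>A. vd x p \<le> R}"
proof -
  define C where "C R = {x \<in> V. \<forall>p\<in>A. vd x p \<le> R}" for R
  define R where "R = (LEAST R. C R \<noteq> {})"
  have "C B \<noteq> {}" using assms by (auto simp: C_def)
  then have ne: "C R \<noteq> {}" unfolding R_def by (rule LeastI)
  have min: "R \<le> R'" if "C R' \<noteq> {}" for R'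
    unfolding R_def using that by (rule Least_le)
  obtain a where a: "a \<in> A" using assms(2) by blast
  have adj: "(x, y) \<in> E" if xy: "x \<in> C R" "y \<in> C R" "x \<noteq> y" for x y
  proof -
    have V: "x \<in> V" "y \<in> V" using xy by (auto simp: C_def)
    obtain z where z: "(x, z) \<in> E" "vd y x = Suc (vd y z)"
      using closer_exists[of y x] V xy by metis
    have zV: "z \<in> V" using z edge_V by blast
    have yz: "y \<in> half x z" using z V by (simp add: half_def)
    have "z = y"
    proof (rule ccontr)
      assume "z \<noteq> y"
      then have pos: "vd y z > 0" using vd_zero V zV by (metis gr0I)
      have "Suc (vd z p) \<le> R" if p: "p \<in> A" for p
      proof (cases "p \<in> half x z")
        case True
        then show ?thesis using half_Suc[OF z(1) True] xy p
          by (auto simp: C_def vd_sym[of x] vd_sym[of z])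
      next
        case False
        then have p': "p \<in> half z x" using not_half[OF z(1), of p] p assms(1) by blast
        have "vd y p = Suc (vd y z + vd x p)" using half_gate[OF z(1) yz p'] .
        moreover have "vd z p = Suc (vd x p)"
          using half_Suc[OF edge_sym[OF z(1)] p'] by (simp add: vd_sym[of z] vd_sym[of x])
        moreover have "vd y p \<le> R" using xy p by (simp add: C_def)
        ultimately show ?thesis using pos by linarith
      qed
      \<comment> \<open>A point of \<open>A\<close> bounds \<open>R\<close> from below by 1, so the
        subtraction in \<open>R - 1\<close> is genuine.\<close>
      then have "z \<in> C (R - 1)" "R \<ge> 1" using zV a by (force simp: C_def)+
      with min[of "R - 1"] show False by force
    qed
    with z show ?thesis by simp
  qed
  obtain x where x: "x \<in> C R" using ne by blast
  have "finite (C R)"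
  proof (cases "C R = {x}")
    case False
    then obtain y where y: "y \<in> C R" "y \<noteq> x" using x by blast
    have "C R \<subseteq> {x, y}"
    proof
      fix z assume z: "z \<in> C R"
      show "z \<in> {x, y}"
      proof (rule ccontr)
        assume "z \<notin> {x, y}"
        then have "(z, x) \<in> E" "(z, y) \<in> E" "(x, y) \<in> E" using adj x y z by blast+
        then show False using vd_edge_neq[of z x y] vd_edge edge_V by auto
      qed
    qed
    then show ?thesis using finite_subset by blast
  qed simp
  with ne that show thesis unfolding C_def by blast
qed

lemma equiv_cofinal: "equiv (rays T) (cofinal_rel T)"
proof (rule equivI)
  show "cofinal_rel T \<subseteq> rays T \<times> rays T" by (auto simp: cofinal_rel_def)
  show "refl_on (rays T) (cofinal_rel T)" by (auto simp: cofinal_rel_def refl_on_def)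
  have "(s, r) \<in> cofinal_rel T" if rs: "(r, s) \<in> cofinal_rel T" for r s
  proof -
    obtain m n where "\<And>k. r (m + k) = s (n + k)" using rs by (auto simp: cofinal_rel_def)
    then have "\<forall>k. s (n + k) = r (m + k)" by simp
    with rs show ?thesis by (auto simp: cofinal_rel_def)
  qed
  then show "sym (cofinal_rel T)" by (rule symI)
  show "trans (cofinal_rel T)"
  proof (rule transI)
    fix r s t assume rs: "(r, s) \<in> cofinal_rel T" and st: "(s, t) \<in> cofinal_rel T"
    obtain m n where mn: "\<And>k. r (m + k) = s (n + k)" using rs by (auto simp: cofinal_rel_def)
    obtain m' n' where mn': "\<And>k. s (m' + k) = t (n' + k)" using st by (auto simp: cofinal_rel_def)
    have "r (m + m' + k) = t (n' + n + k)" for k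
      using mn[of "m' + k"] mn'[of "n + k"] by (simp add: ac_simps)
    with rs st show "(r, t) \<in> cofinal_rel T" by (auto simp: cofinal_rel_def)
  qed
qed

lemma V_nonempty: "V \<noteq> {}"
  using tree by (simp add: is_tree_def Digraph_Component.connected_def strongly_connected_def mk_symmetric_def)

end

section \<open>Group actions on trees\<close>

locale acting_on_tree = tree_graph T + group G
  for T :: "'v pair_pre_digraph" and G :: "('g, 'c) monoid_scheme" (structure) +
  fixes \<phi> :: "'g \<Rightarrow> 'v \<Rightarrow> 'v"
  assumes action: "tree_action G T \<phi>"
begin

sublocale group_action G V \<phi>
  using action by (simp add: tree_action_def)

lemma act_V [simp]: "\<lbrakk>g \<in> carrier G; x \<in> V\<rbrakk> \<Longrightarrow> \<phi> g x \<in> V"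
  using element_image by blast

lemma act_one [simp]: "x \<in> V \<Longrightarrow> \<phi> \<one> x = x"
  using id_eq_one by (metis restrict_apply')

lemma act_inv: "\<lbrakk>g \<in> carrier G; x \<in> V\<rbrakk> \<Longrightarrow> \<phi> (inv g) (\<phi> g x) = x"
  using composition_rule[of x "inv g" g] by simp

lemma act_inv': "\<lbrakk>g \<in> carrier G; x \<in> V\<rbrakk> \<Longrightarrow> \<phi> g (\<phi> (inv g) x) = x"
  using composition_rule[of x g "inv g"] by simp

lemma act_inj: "\<lbrakk>g \<in> carrier G; x \<in> V; y \<in> V\<rbrakk> \<Longrightarrow> \<phi> g x = \<phi> g y \<longleftrightarrow> x = y"
  using act_inv by metis

lemma act_edge: "\<lbrakk>g \<in> carrier G; (x, y) \<in> E\<rbrakk> \<Longrightarrow> (\<phi> g x, \<phi> g y) \<in> E"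
  using action by (auto simp: tree_action_def)

lemma act_vd_le:
  assumes "g \<in> carrier G" "x \<in> V" "y \<in> V" shows "vd (\<phi> g x) (\<phi> g y) \<le> vd x y"
proof -
  have "(\<phi> g x, \<phi> g y) \<in> E ^^ n" if "(x, y) \<in> E ^^ n" for n
    using that by (induction n arbitrary: y) (auto dest: act_edge[OF assms(1)])
  then show ?thesis using assms vd_le vd_relpow by blast
qed

lemma act_vd:
  assumes "g \<in> carrier G" "x \<in> V" "y \<in> V" shows "vd (\<phi> g x) (\<phi> g y) = vd x y"
  using act_vd_le[OF assms] act_vd_le[of "inv g" "\<phi> g x" "\<phi> g y"] assms
  by (simp add: act_inv)

lemma act_half_iff:
  assumes "g \<in> carrier G" "x \<in> V" "y \<in> V" "p \<in> V"
  shows "\<phi> g p \<in> half (\<phi> g x) (\<phi> g y) \<longleftrightarrow> p \<in> half x y"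
  using assms by (simp add: half_def act_vd)

lemma act_half:
  assumes "g \<in> carrier G" "x \<in> V" "y \<in> V"
  shows "\<phi> g ` half x y = half (\<phi> g x) (\<phi> g y)"
proof (intro equalityI subsetI)
  fix p assume p: "p \<in> half (\<phi> g x) (\<phi> g y)"
  then have pV: "p \<in> V" using half_V by blast
  then have "\<phi> g (\<phi> (inv g) p) = p" using assms act_inv' by blast
  then show "p \<in> \<phi> g ` half x y"
    using p act_half_iff[OF assms, of "\<phi> (inv g) p"] assms pV by (metis act_V image_eqI inv_closed)
qed (use assms act_half_iff half_V in blast)

lemma elementary_finite:
  assumes "D \<subseteq> V" "D \<noteq> {}" "finite D" "\<And>g x. \<lbrakk>g \<in> carrier G; x \<in> D\<rbrakk> \<Longrightarrow> \<phi> g x \<in> D"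
  shows "elementary_action G T \<phi>"
proof -
  obtain x where x: "x \<in> D" using assms by blast
  then have "orbit G \<phi> x \<subseteq> D" using assms by (auto simp: orbit_def)
  then show ?thesis using x assms finite_subset unfolding elementary_action_def by blast
qed

lemma elementary_bounded:
  assumes "x \<in> V" "\<And>g. g \<in> carrier G \<Longrightarrow> vd (\<phi> g x) x \<le> B"
  shows "elementary_action G T \<phi>"
proof -
  let ?A = "orbit G \<phi> x"
  have AV: "?A \<subseteq> V" using assms by (auto simp: orbit_def)
  have xA: "x \<in> ?A" using orbit_refl assms(1) .
  have actA: "\<phi> g p \<in> ?A" if "g \<in> carrier G" "p \<in> ?A" for g p
  proof -
    obtain h where "h \<in> carrier G" "p = \<phi> h x" using \<open>p \<in> ?A\<close> by (auto simp: orbit_def)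
    then have "\<phi> g p = \<phi> (g \<otimes> h) x" using composition_rule that(1) assms(1) by simp
    then show ?thesis using \<open>h \<in> carrier G\<close> that(1) unfolding orbit_def by blast
  qed
  have "vd p q \<le> B + B" if "p \<in> ?A" "q \<in> ?A" for p q
  proof -
    have "vd p x \<le> B" "vd q x \<le> B" using that assms by (auto simp: orbit_def)
    then show ?thesis using vd_triangle[of p x q] vd_sym[of x q] that AV assms(1) by fastforce
  qed
  then obtain R where R: "{y \<in> V. \<forall>p\<in>?A. vd y p \<le> R} \<noteq> {}" "finite {y \<in> V. \<forall>p\<in>?A. vd y p \<le> R}"
    using finite_centre[OF AV] xA by blast
  show ?thesis
  proof (rule elementary_finite[OF _ R])
    fix g y assume g: "g \<in> carrier G" and y: "y \<in> {y \<in> V. \<forall>p\<in>?A. vd y p \<le> R}"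
    have "vd (\<phi> g y) p \<le> R" if p: "p \<in> ?A" for p
    proof -
      have "vd (\<phi> g y) (\<phi> g (\<phi> (inv g) p)) = vd y (\<phi> (inv g) p)"
        using g y p AV by (intro act_vd) auto
      then show ?thesis using y actA[of "inv g" p] g p act_inv'[of g p] AV by auto
    qed
    with g y show "\<phi> g y \<in> {y \<in> V. \<forall>p\<in>?A. vd y p \<le> R}" by simp
  qed blast
qed

section \<open>The action on rays and ends\<close>

lemma act_ray:
  assumes "g \<in> carrier G" "r \<in> rays T" shows "\<phi> g \<circ> r \<in> rays T"
  using assms act_edge act_inj ray_V[OF assms(2)] by (auto simp: rays_def inj_def)

lemma act_ray_inv:
  assumes "g \<in> carrier G" "r \<in> rays T" shows "\<phi> g \<circ> (\<phi> (inv g) \<circ> r) = r"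
  using assms act_inv' ray_V[OF assms(2)] by auto

lemma act_cofinal:
  assumes "g \<in> carrier G" "(r, s) \<in> cofinal_rel T" shows "(\<phi> g \<circ> r, \<phi> g \<circ> s) \<in> cofinal_rel T"
proof -
  obtain m n where "\<forall>k. r (m + k) = s (n + k)" using assms(2) by (auto simp: cofinal_rel_def)
  then have "\<forall>k. (\<phi> g \<circ> r) (m + k) = (\<phi> g \<circ> s) (n + k)" by simp
  moreover have "\<phi> g \<circ> r \<in> rays T" "\<phi> g \<circ> s \<in> rays T"
    using assms act_ray by (simp_all add: cofinal_rel_def)
  ultimately show ?thesis unfolding cofinal_rel_def by blast
qed

lemma end_action_class:
  assumes "g \<in> carrier G" "r \<in> rays T"
  shows "end_action \<phi> g (cofinal_rel T `` {r}) = cofinal_rel T `` {\<phi> g \<circ> r}"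
proof (intro equalityI subsetI)
  fix s assume s: "s \<in> cofinal_rel T `` {\<phi> g \<circ> r}"
  then have sr: "s \<in> rays T" by (auto simp: cofinal_rel_def)
  have "(\<phi> (inv g) \<circ> (\<phi> g \<circ> r), \<phi> (inv g) \<circ> s) \<in> cofinal_rel T"
    using s assms by (intro act_cofinal) auto
  then have "\<phi> (inv g) \<circ> s \<in> cofinal_rel T `` {r}"
    using act_ray_inv[of "inv g" r] assms by simp
  then show "s \<in> end_action \<phi> g (cofinal_rel T `` {r})"
    unfolding end_action_def using act_ray_inv[OF assms(1) sr] by (metis image_eqI)
qed (use assms act_cofinal in \<open>auto simp: end_action_def\<close>)

text \<open>Fitted to heavy rays: it suffices to control an invariant family of rays instead of full
  classes, and \<open>S\<close> is any finite supply of representatives. The orbit of one class then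
  consists of classes of members of \<open>S\<close>.\<close>

lemma elementary_rays:
  assumes "R \<subseteq> rays T" "R \<noteq> {}" "\<And>g r. \<lbrakk>g \<in> carrier G; r \<in> R\<rbrakk> \<Longrightarrow> \<phi> g \<circ> r \<in> R"
    and "finite S" "\<And>r. r \<in> R \<Longrightarrow> \<exists>s\<in>S. (r, s) \<in> cofinal_rel T"
  shows "elementary_action G T \<phi>"
proof -
  obtain r where r: "r \<in> R" using assms by blast
  then have "cofinal_rel T `` {r} \<in> ends T" unfolding ends_def using assms by (blast intro: quotientI)
  moreover have "orbit G (end_action \<phi>) (cofinal_rel T `` {r}) \<subseteq> (\<lambda>s. cofinal_rel T `` {s}) ` S"
  proof
    fix \<xi> assume "\<xi> \<in> orbit G (end_action \<phi>) (cofinal_rel T `` {r})"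
    then obtain g where g: "g \<in> carrier G" "\<xi> = cofinal_rel T `` {\<phi> g \<circ> r}"
      using end_action_class assms r unfolding orbit_def by blast
    then obtain s where "s \<in> S" "(\<phi> g \<circ> r, s) \<in> cofinal_rel T" using assms r by meson
    then show "\<xi> \<in> (\<lambda>s. cofinal_rel T `` {s}) ` S"
      using g equiv_class_eq[OF equiv_cofinal] by blast
  qed
  ultimately show ?thesis
    using assms(4) finite_surj unfolding elementary_action_def by blast
qed

end

section \<open>Invariant means on the vertices\<close>

text \<open>A neighbour \<open>y\<close> of \<open>x\<close> is heavy if at least half of the mass lies beyond the edge from \<open>x\<close> to
  \<open>y\<close>.  If some vertex has no heavy neighbour, it is unique, hence fixed.  Otherwise one follows heavy
  edges: a path can only be forced to turn back at a dead end, of which there are at most two, and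
  without dead ends the heavy rays represent finitely many ends, since no three
  half trees of mass at least 1/2 are disjoint.\<close>

locale invariant_mean = acting_on_tree T G \<phi>
  for T :: "'v pair_pre_digraph" and G :: "('g, 'c) monoid_scheme" (structure) and \<phi> +
  fixes m :: "'v set \<Rightarrow> real"
  assumes mean_V: "m V = 1"
    and mean_nonneg: "A \<subseteq> V \<Longrightarrow> 0 \<le> m A"
    and mean_add: "\<lbrakk>A \<subseteq> V; B \<subseteq> V; A \<inter> B = {}\<rbrakk> \<Longrightarrow> m (A \<union> B) = m A + m B"
    and mean_act: "\<lbrakk>g \<in> carrier G; A \<subseteq> V\<rbrakk> \<Longrightarrow> m (\<phi> g ` A) = m A"
begin

lemma mean_mono:
  assumes "A \<subseteq> B" "B \<subseteq> V" shows "m A \<le> m B"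
proof -
  have "m B = m (A \<union> (B - A))" using assms by (simp add: Un_absorb1)
  also have "\<dots> = m A + m (B - A)" using assms by (intro mean_add) auto
  finally show ?thesis using mean_nonneg[of "B - A"] assms by auto
qed

lemma mean_disjoint2:
  assumes "A \<subseteq> V" "B \<subseteq> V" "A \<inter> B = {}" shows "m A + m B \<le> 1"
  using mean_add[OF assms] mean_mono[of "A \<union> B" V] assms mean_V by simp

lemma mean_disjoint3:
  assumes "A \<subseteq> V" "B \<subseteq> V" "C \<subseteq> V" "A \<inter> B = {}" "A \<inter> C = {}" "B \<inter> C = {}"
  shows "m A + m B + m C \<le> 1"
proof -
  have "m (A \<union> B) = m A + m B" using assms by (intro mean_add)
  moreover have "m (A \<union> B) + m C \<le> 1" using assms by (intro mean_disjoint2) auto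
  ultimately show ?thesis by simp
qed

section \<open>The mass beyond an edge\<close>

definition flow :: "'v \<Rightarrow> 'v \<Rightarrow> real" where
  "flow x y = m (half x y)"

definition heavy :: "'v \<Rightarrow> 'v \<Rightarrow> bool" where
  "heavy x y \<longleftrightarrow> (x, y) \<in> E \<and> 1/2 \<le> flow x y"

lemma flow_rev:
  assumes "(x, y) \<in> E" shows "flow x y + flow y x = 1"
proof -
  have "half y x = V - half x y" using half_compl[OF assms] by simp
  moreover have "half x y \<union> (V - half x y) = V" using half_V by blast
  ultimately show ?thesis using mean_add[of "half x y" "V - half x y"] half_V mean_V by (auto simp: flow_def)
qed

lemma flow_mono: "half x y \<subseteq> half u w \<Longrightarrow> flow x y \<le> flow u w"
  unfolding flow_def by (intro mean_mono half_V)

lemma flow_act: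
  assumes "g \<in> carrier G" "(x, y) \<in> E" shows "flow (\<phi> g x) (\<phi> g y) = flow x y"
  using mean_act[OF assms(1) half_V[of x y]] act_half[OF assms(1) edge_V[OF assms(2)]]
  by (simp add: flow_def)

lemma flow2:
  assumes "(x, y) \<in> E" "(x, z) \<in> E" "y \<noteq> z" shows "flow x y + flow x z \<le> 1"
  unfolding flow_def using assms by (intro mean_disjoint2 half_V half_disjoint)

lemma flow3:
  assumes "(x, y) \<in> E" "(x, z) \<in> E" "(x, w) \<in> E" "y \<noteq> z" "y \<noteq> w" "z \<noteq> w"
  shows "flow x y + flow x z + flow x w \<le> 1"
  unfolding flow_def using assms by (intro mean_disjoint3 half_V half_disjoint)

lemma heavy_act: "\<lbrakk>g \<in> carrier G; heavy x y\<rbrakk> \<Longrightarrow> heavy (\<phi> g x) (\<phi> g y)"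
  by (simp add: heavy_def flow_act act_edge)

lemma heavy_act_iff:
  assumes "g \<in> carrier G" "x \<in> V" "y \<in> V" shows "heavy (\<phi> g x) y \<longleftrightarrow> heavy x (\<phi> (inv g) y)"
  using heavy_act[of g x "\<phi> (inv g) y"] heavy_act[of "inv g" "\<phi> g x" y] assms act_inv act_inv' by auto

lemma heavy_V: "heavy x y \<Longrightarrow> x \<in> V" "heavy x y \<Longrightarrow> y \<in> V"
  using edge_V by (auto simp: heavy_def)

text \<open>There are at most two heavy neighbours, since three would give disjoint half trees of
  total mass at least 3/2.\<close>

lemma finite_heavy: "finite {y. heavy x y}"
proof (cases "\<exists>y z. heavy x y \<and> heavy x z \<and> y \<noteq> z")
  case True
  then obtain y z where yz: "heavy x y" "heavy x z" "y \<noteq> z" by blast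
  have "{y. heavy x y} \<subseteq> {y, z}"
    using flow3[of x y z] yz by (force simp: heavy_def)
  then show ?thesis using finite_subset by blast
next
  case False
  then have "\<exists>y. {y. heavy x y} \<subseteq> {y}" by blast
  then show ?thesis using finite_subset by blast
qed

text \<open>Two such vertices would each send a light edge towards the other; what lies behind the
  first edge has mass above 1/2, yet it is contained in the light half tree of the second.\<close>

lemma elementary_sink:
  assumes "x \<in> V" "\<And>y. \<not> heavy x y"
  shows "elementary_action G T \<phi>"
proof (rule elementary_finite[of "{x}"])
  have unique: "x' = x" if x': "x' \<in> V" "\<And>y. \<not> heavy x' y" for x'
  proof (rule ccontr)
    assume "x' \<noteq> x"
    then obtain y where y: "(x, y) \<in> E" "x' \<in> half x y"
      using closer_half[of x' x] assms x' by blast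
    obtain y' where y': "(x', y') \<in> E" "x \<in> half x' y'"
      using closer_half[of x x'] assms x' \<open>x' \<noteq> x\<close> by metis
    have "flow y x \<le> flow x' y'" using y y' by (intro flow_mono half_cover)
    moreover have "flow x y < 1/2" "flow x' y' < 1/2"
      using assms(2) x'(2) y y' by (auto simp: heavy_def not_le)
    ultimately show False using flow_rev[OF y(1)] by linarith
  qed
  fix g y assume g: "g \<in> carrier G" and "y \<in> {x}"
  then have y: "y = x" by simp
  have "\<not> heavy (\<phi> g x) z" for z
    using heavy_act_iff[of g x z] g assms heavy_V by blast
  then show "\<phi> g y \<in> {x}" using unique[of "\<phi> g x"] g assms y by simp
qed (use assms in auto)

text \<open>The reversed edge also has mass 1/2 and is heavy, so a heavy path arriving from
  \<open>z\<close> could only turn back.\<close>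

definition dead_end :: "'v \<Rightarrow> 'v \<Rightarrow> bool" where
  "dead_end x z \<longleftrightarrow> heavy x z \<and> flow x z = 1/2 \<and> (\<forall>w. heavy x w \<longrightarrow> w = z)"

text \<open>Otherwise the direction from \<open>y\<close> to \<open>y'\<close> is light. Yet it
  contains everything that lies beyond \<open>y'\<close> as seen from \<open>y\<close>, and this has
  mass at least 1/2: either it is the complement of the half tree of mass 1/2 at \<open>y'\<close>,
  or it contains that half tree.\<close>

lemma dead_end_half:
  assumes "dead_end y z" "dead_end y' z'" "y \<noteq> y'" shows "y' \<in> half y z"
proof -
  have E: "(y, z) \<in> E" "(y', z') \<in> E" using assms by (auto simp: dead_end_def heavy_def)
  obtain w where w: "(y, w) \<in> E" "y' \<in> half y w"
    using closer_half[of y' y] assms(3) E edge_V by metis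
  obtain w' where w': "(y', w') \<in> E" "y \<in> half y' w'"
    using closer_half[of y y'] assms(3) E edge_V by metis
  have cover: "half w' y' \<subseteq> half y w" using half_cover[OF w'(1) w'(2) w(1) w(2)] .
  have "w = z"
  proof (rule ccontr)
    assume "w \<noteq> z"
    then have "\<not> heavy y w" using assms(1) unfolding dead_end_def by blast
    then have light: "flow y w < 1/2" using w by (simp add: heavy_def)
    show False
    proof (cases "z' = w'")
      case True
      then have "flow w' y' = 1/2" using flow_rev[OF w'(1)] assms(2) by (simp add: dead_end_def)
      then show False using flow_mono[OF cover] light by simp
    next
      case False
      then have "half y' z' \<subseteq> half w' y'"
        using half_step[OF edge_sym[OF w'(1)] E(2)] by simp
      then have "flow y' z' \<le> flow y w" using cover by (intro flow_mono) blast
      then show False using assms(2) light by (simp add: dead_end_def)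
    qed
  qed
  with w show ?thesis by simp
qed

text \<open>The half trees behind two dead ends, away from their heavy neighbours, are disjoint
  because each dead end lies in the heavy half tree of the other. Each has mass 1/2, so there are at
  most two dead ends.\<close>

lemma elementary_dead_end:
  assumes "dead_end x z" shows "elementary_action G T \<phi>"
proof (rule elementary_finite[of "{x. \<exists>z. dead_end x z}"])
  show "{x. \<exists>z. dead_end x z} \<subseteq> V" using heavy_V by (auto simp: dead_end_def)
  show "{x. \<exists>z. dead_end x z} \<noteq> {}" using assms by blast
  show "\<phi> g y \<in> {x. \<exists>z. dead_end x z}" if g: "g \<in> carrier G" and y: "y \<in> {x. \<exists>z. dead_end x z}" for g y
  proof -
    obtain w where w: "dead_end y w" using y by blast
    then have "(y, w) \<in> E" by (simp add: dead_end_def heavy_def)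
    have "v = \<phi> g w" if v: "heavy (\<phi> g y) v" for v
    proof -
      have "heavy y (\<phi> (inv g) v)" using heavy_act_iff[of g y v] g v heavy_V w \<open>(y, w) \<in> E\<close> edge_V by blast
      then have "\<phi> (inv g) v = w" using w by (simp add: dead_end_def)
      then show ?thesis using act_inv'[OF g heavy_V(2)[OF v]] by simp
    qed
    then have "dead_end (\<phi> g y) (\<phi> g w)"
      using w g heavy_act flow_act \<open>(y, w) \<in> E\<close> by (simp add: dead_end_def)
    then show ?thesis by blast
  qed
  have disj: "half w y \<inter> half w' y' = {}" if d: "dead_end y w" "dead_end y' w'" "y \<noteq> y'" for y w y' w'
  proof -
    have E: "(y, w) \<in> E" "(y', w') \<in> E" using d by (auto simp: dead_end_def heavy_def)
    have "half w y \<subseteq> half y' w'"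
      using E dead_end_half[OF d] dead_end_half[OF d(2,1) d(3)[symmetric]] by (intro half_cover)
    then show ?thesis using half_compl[OF E(2)] by blast
  qed
  have mass: "m (half w y) = 1/2" if d: "dead_end y w" for y w
    using flow_rev[of y w] d by (simp add: dead_end_def heavy_def flow_def)
  show "finite {x. \<exists>z. dead_end x z}"
  proof (cases "\<exists>y w. dead_end y w \<and> y \<noteq> x")
    case True
    then obtain y w where y: "dead_end y w" "y \<noteq> x" by blast
    have "u \<in> {x, y}" if u: "dead_end u v" for u v
    proof (rule ccontr)
      assume "u \<notin> {x, y}"
      then have "m (half v u) + m (half z x) + m (half w y) \<le> 1"
        using u y assms by (intro mean_disjoint3 half_V disj) auto
      then show False using mass u y assms by simp
    qed
    then have "{x. \<exists>z. dead_end x z} \<subseteq> {x, y}" by blast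
    then show ?thesis using finite_subset by blast
  next
    case False
    then have "{x. \<exists>z. dead_end x z} \<subseteq> {x}" by blast
    then show ?thesis using finite_subset by blast
  qed
qed

section \<open>Rays along heavy edges\<close>

definition heavy_ray :: "(nat \<Rightarrow> 'v) \<Rightarrow> bool" where
  "heavy_ray r \<longleftrightarrow> (\<forall>n. heavy (r n) (r (Suc n)) \<and> r (Suc (Suc n)) \<noteq> r n)"

lemma heavy_ray_rays: "heavy_ray r \<Longrightarrow> r \<in> rays T"
  by (intro nonbacktracking_ray) (auto simp: heavy_ray_def heavy_def)

lemma heavy_ray_act:
  assumes "g \<in> carrier G" "heavy_ray r" shows "heavy_ray (\<phi> g \<circ> r)"
  using assms heavy_act act_inj[OF assms(1)] ray_V[OF heavy_ray_rays[OF assms(2)]]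
  by (simp add: heavy_ray_def)

lemma heavy_ray_exists:
  assumes "heavy x y" and continue: "\<And>x y. heavy x y \<Longrightarrow> \<exists>z. heavy y z \<and> z \<noteq> x"
  shows "\<exists>r. heavy_ray r"
proof -
  \<comment> \<open>The choice runs over edges, because the next vertex has to avoid the last but
    one.\<close>
  have "\<exists>s. \<forall>n. heavy (fst (s n)) (snd (s n)) \<and>
      (fst (s (Suc n)) = snd (s n) \<and> snd (s (Suc n)) \<noteq> fst (s n))"
  proof (rule dependent_nat_choice)
    show "\<exists>p. heavy (fst p) (snd p)" using assms(1) by (intro exI[of _ "(x, y)"]) simp
    fix p :: "'v \<times> 'v" and n :: nat
    assume "heavy (fst p) (snd p)"
    from continue[OF this] obtain z where "heavy (snd p) z" "z \<noteq> fst p" by blast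
    then show "\<exists>q. heavy (fst q) (snd q) \<and> fst q = snd p \<and> snd q \<noteq> fst p"
      by (intro exI[of _ "(snd p, z)"]) simp
  qed
  then obtain s where s: "\<And>n. heavy (fst (s n)) (snd (s n))" "\<And>n. fst (s (Suc n)) = snd (s n)"
      "\<And>n. snd (s (Suc n)) \<noteq> fst (s n)" by blast
  then have "heavy_ray (fst \<circ> s)" by (simp add: heavy_ray_def)
  then show ?thesis by blast
qed

text \<open>The starting point moves one edge at a time without changing the end. From
  \<open>y\<close> to \<open>x\<close>, the ray is shortened if its first step goes to
  \<open>x\<close> and prolonged otherwise; the new edge is then heavy because the half tree beyond
  it contains the one beyond the first edge of the old ray.\<close>

lemma heavy_ray_from:
  assumes "heavy_ray r" "x \<in> V"
  shows "\<exists>s. heavy_ray s \<and> s 0 = x \<and> (\<exists>m n. \<forall>k. r (m + k) = s (n + k))"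
  using assms(2)
proof (induction "vd (r 0) x" arbitrary: x)
  case 0
  then have "r 0 = x" using vd_zero ray_V[OF heavy_ray_rays[OF assms(1)]] by metis
  with assms(1) show ?case by (intro exI[of _ r]) auto
next
  case (Suc d)
  have r0: "r 0 \<in> V" using ray_V[OF heavy_ray_rays[OF assms(1)]] .
  have "r 0 \<noteq> x" using Suc.hyps(2) by auto
  then obtain y where y: "(x, y) \<in> E" "vd (r 0) x = Suc (vd (r 0) y)"
    using closer_exists[OF r0 Suc.prems] by blast
  then obtain s m n where s: "heavy_ray s" "s 0 = y" and mn: "\<And>k. r (m + k) = s (n + k)"
    using Suc.hyps edge_V by (metis Suc_inject)
  show ?case
  proof (cases "s 1 = x")
    case True
    have "\<forall>k. r (Suc m + k) = s (Suc (n + k))" using mn[of "Suc _"] by simp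
    then have "\<exists>m n. \<forall>k. r (m + k) = s (Suc (n + k))" by blast
    then show ?thesis using s True
      by (intro exI[of _ "\<lambda>k. s (Suc k)"]) (simp add: heavy_ray_def)
  next
    case False
    have sE: "(y, s 1) \<in> E" "1/2 \<le> flow y (s 1)" using s by (auto simp: heavy_ray_def heavy_def)
    have "flow y (s 1) \<le> flow x y"
      using half_step[OF y(1) sE(1)] False by (intro flow_mono) simp
    then have "heavy x y" using y sE by (simp add: heavy_def)
    moreover have "heavy_ray (case_nat x s)"
      unfolding heavy_ray_def
    proof
      fix k show "heavy (case_nat x s k) (case_nat x s (Suc k)) \<and> case_nat x s (Suc (Suc k)) \<noteq> case_nat x s k"
        using s \<open>heavy x y\<close> False by (cases k) (auto simp: heavy_ray_def)
    qed
    moreover have "\<forall>k. r (m + k) = case_nat x s (Suc n + k)" using mn by simp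
    then have "\<exists>m n. \<forall>k. r (m + k) = case_nat x s (n + k)" by blast
    ultimately show ?thesis by (intro exI[of _ "case_nat x s"]) simp
  qed
qed

text \<open>A mass of exactly 1/2 excludes branching: mass 1/2 stays behind each vertex reached, so
  there is room for only one onward heavy neighbour, again with mass exactly 1/2.\<close>

lemma heavy_ray_determined:
  assumes "heavy_ray r" "heavy_ray s" "r 0 = s 0" "r 1 = s 1" "flow (r 0) (r 1) = 1/2"
  shows "r = s"
proof -
  have "r n = s n \<and> r (Suc n) = s (Suc n) \<and> flow (r n) (r (Suc n)) = 1/2" for n
  proof (induction n)
    case (Suc n)
    let ?y = "r (Suc n)"
    have E: "(r n, ?y) \<in> E" "(?y, r (Suc (Suc n))) \<in> E" "(?y, s (Suc (Suc n))) \<in> E"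
      and nb: "r (Suc (Suc n)) \<noteq> r n" "s (Suc (Suc n)) \<noteq> r n"
      and fl: "1/2 \<le> flow ?y (r (Suc (Suc n)))" "1/2 \<le> flow ?y (s (Suc (Suc n)))"
      using assms(1,2) Suc unfolding heavy_ray_def heavy_def by metis+
    have rev: "flow ?y (r n) = 1/2" using flow_rev[OF E(1)] Suc by linarith
    have "r (Suc (Suc n)) = s (Suc (Suc n))"
      using flow3[OF edge_sym[OF E(1)] E(2,3) nb[symmetric]] fl rev by linarith
    moreover have "flow ?y (r (Suc (Suc n))) = 1/2"
      using flow2[OF edge_sym[OF E(1)] E(2) nb(1)[symmetric]] fl rev by linarith
    ultimately show ?case using Suc by simp
  qed (use assms in auto)
  then show ?thesis by blast
qed

text \<open>Two heavy neighbours of one vertex share the mass equally. If some heavy edge has mass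
  1/2, all heavy edges at its origin \<open>a\<close> do, and \<open>heavy_ray_determined\<close>
  applies there; if none does, heavy neighbours are unique and any vertex serves.\<close>

lemma base_vertex_exists:
  obtains a where "a \<in> V"
    "\<And>r s. \<lbrakk>heavy_ray r; heavy_ray s; r 0 = a; s 0 = a; r 1 = s 1\<rbrakk> \<Longrightarrow> r = s"
proof (cases "\<exists>a b. heavy a b \<and> flow a b = 1/2")
  case True
  then obtain a b where ab: "heavy a b" "flow a b = 1/2" by blast
  have "flow a c = 1/2" if "heavy a c" for c
    using flow2[of a b c] ab that by (cases "c = b") (auto simp: heavy_def)
  then show thesis using that[of a] heavy_ray_determined heavy_V ab
    by (metis One_nat_def heavy_ray_def)
next
  case False
  have unique: "y = z" if "heavy x y" "heavy x z" for x y z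
    using False flow2[of x y z] that by (force simp: heavy_def)
  obtain a where "a \<in> V" using V_nonempty by blast
  then show thesis
  proof (rule that)
    fix r s assume rs: "heavy_ray r" "heavy_ray s" "r 0 = a" "s 0 = a"
    have "r n = s n" for n
      proof (induction n)
      case (Suc n)
      then show ?case using rs unique unfolding heavy_ray_def by metis
    qed (use rs in simp)
    then show "r = s" by blast
  qed
qed

theorem elementary: "elementary_action G T \<phi>"
proof (cases "\<exists>x\<in>V. \<forall>y. \<not> heavy x y")
  case True
  then show ?thesis using elementary_sink by blast
next
  case sink: False
  show ?thesis
  proof (cases "\<exists>x z. dead_end x z")
    case True
    then show ?thesis using elementary_dead_end by blast
  next
    case False
    have continue: "\<exists>z. heavy y z \<and> z \<noteq> x" if xy: "heavy x y" for x y
    proof (rule ccontr)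
      assume neg: "\<nexists>z. heavy y z \<and> z \<noteq> x"
      then have "heavy y x" using sink heavy_V(2)[OF xy] by blast
      \<comment> \<open>Both orientations of the edge are heavy and their masses add up to
        1.\<close>
      then have "flow y x = 1/2" using xy flow_rev[of x y] by (auto simp: heavy_def)
      then have "dead_end y x" using neg \<open>heavy y x\<close> unfolding dead_end_def by blast
      with False show False by blast
    qed
    obtain x y where "heavy x y" using sink V_nonempty by blast
    then have ne: "{r. heavy_ray r} \<noteq> {}" using heavy_ray_exists continue by blast
    obtain a where a: "a \<in> V"
      and det: "\<And>r s. \<lbrakk>heavy_ray r; heavy_ray s; r 0 = a; s 0 = a; r 1 = s 1\<rbrakk> \<Longrightarrow> r = s"
      using base_vertex_exists by blast
    \<comment> \<open>These rays are determined by their first step, hence finite in number, and by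
      \<open>heavy_ray_from\<close> every heavy ray is cofinal with one of them.\<close>
    let ?S = "{r. heavy_ray r \<and> r 0 = a}"
    have "inj_on (\<lambda>r. r 1) ?S" by (rule inj_onI) (use det in blast)
    moreover have "(\<lambda>r. r 1) ` ?S \<subseteq> {y. heavy a y}" by (auto simp: heavy_ray_def)
    ultimately have "finite ?S" using finite_heavy inj_on_finite by blast
    moreover have "\<exists>s\<in>?S. (r, s) \<in> cofinal_rel T" if "heavy_ray r" for r
      using heavy_ray_from[OF that a] that heavy_ray_rays unfolding cofinal_rel_def by blast
    ultimately show ?thesis
      using elementary_rays[of "{r. heavy_ray r}" ?S] ne heavy_ray_act heavy_ray_rays by blast
  qed
qed

end

section \<open>Square-summable functions\<close>

text \<open>Routed through \<open>ell2_dist\<close>, so that definiteness and the triangle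
  inequality are inherited from \<open>Metric_space_ell2\<close>.\<close>

definition ell2_norm :: "'e set \<Rightarrow> ('e \<Rightarrow> complex) \<Rightarrow> real" where
  "ell2_norm E f = ell2_dist E f 0"

lemma ell2_dist_norm: "ell2_dist E f g = ell2_norm E (f - g)"
  by (simp add: ell2_norm_def ell2_dist_def)

lemma ell2_norm_square: "(ell2_norm E f)\<^sup>2 = (\<Sum>\<^sub>\<infinity>e\<in>E. (cmod (f e))\<^sup>2)"
  by (simp add: ell2_norm_def ell2_dist_def infsum_nonneg)

lemma ell2_norm_nonneg [simp]: "0 \<le> ell2_norm E f"
  by (simp add: ell2_norm_def ell2_dist_def infsum_nonneg)

lemma ell2_norm_zero [simp]: "ell2_norm E 0 = 0"
  by (simp add: ell2_norm_def ell2_dist_def)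

lemma ell2_norm_uminus: "ell2_norm E (- f) = ell2_norm E f"
  by (simp add: ell2_norm_def ell2_dist_def)

lemma ell2_norm_minus_commute: "ell2_norm E (f - g) = ell2_norm E (g - f)"
  using ell2_norm_uminus[of E "f - g"] by simp

lemma ell2_zero [simp]: "0 \<in> ell2 E"
  by (simp add: ell2_def)

lemma ell2_scale [intro]: "f \<in> ell2 E \<Longrightarrow> (\<lambda>e. c * f e) \<in> ell2 E"
  by (auto simp: ell2_def norm_mult power_mult_distrib intro: summable_on_cmult_right)

lemma ell2_uminus [intro]: "f \<in> ell2 E \<Longrightarrow> - f \<in> ell2 E"
  by (simp add: ell2_def)

lemma ell2_diff [intro]: "\<lbrakk>f \<in> ell2 E; g \<in> ell2 E\<rbrakk> \<Longrightarrow> f - g \<in> ell2 E"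
  using ell2_diff_summable[of f E g] by (simp add: ell2_def)

lemma ell2_add [intro]: "\<lbrakk>f \<in> ell2 E; g \<in> ell2 E\<rbrakk> \<Longrightarrow> f + g \<in> ell2 E"
  using ell2_diff[of f E "- g"] by auto

lemma ell2_sum [intro]: "(\<And>i. i \<in> I \<Longrightarrow> f i \<in> ell2 E) \<Longrightarrow> (\<Sum>i\<in>I. f i) \<in> ell2 E"
  by (induction I rule: infinite_finite_induct) auto

lemma ell2_norm_scale: "ell2_norm E (\<lambda>e. c * f e) = cmod c * ell2_norm E f"
  by (simp add: ell2_norm_def ell2_dist_def norm_mult power_mult_distrib infsum_cmult_right' real_sqrt_mult)

lemma ell2_norm_triangle:
  assumes "f \<in> ell2 E" "g \<in> ell2 E"
  shows "ell2_norm E (f + g) \<le> ell2_norm E f + ell2_norm E g"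
  using Metric_space.triangle[OF Metric_space_ell2, of "f + g" E g 0] assms
  by (auto simp: ell2_dist_norm)

lemma ell2_norm_triangle_diff:
  assumes "f \<in> ell2 E" "g \<in> ell2 E"
  shows "ell2_norm E (f - g) \<le> ell2_norm E f + ell2_norm E g"
  using ell2_norm_triangle[of f E "- g"] assms by (auto simp: ell2_norm_uminus)

lemma ell2_norm_sum:
  "(\<And>i. i \<in> I \<Longrightarrow> f i \<in> ell2 E) \<Longrightarrow> ell2_norm E (\<Sum>i\<in>I. f i) \<le> (\<Sum>i\<in>I. ell2_norm E (f i))"
proof (induction I rule: infinite_finite_induct)
  case (insert i I)
  have "ell2_norm E (f i + (\<Sum>i\<in>I. f i)) \<le> ell2_norm E (f i) + ell2_norm E (\<Sum>i\<in>I. f i)"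
    using insert by (intro ell2_norm_triangle) auto
  moreover have "ell2_norm E (\<Sum>i\<in>I. f i) \<le> (\<Sum>i\<in>I. ell2_norm E (f i))"
    using insert by blast
  ultimately show ?case unfolding sum.insert[OF insert(1,2)] by linarith
qed auto

lemma ell2_norm_eq_0: "f \<in> ell2 E \<Longrightarrow> ell2_norm E f = 0 \<longleftrightarrow> f = 0"
  using Metric_space.zero[OF Metric_space_ell2, of f E 0] by (simp add: ell2_norm_def)

section \<open>Reduced cohomology of a permutation representation\<close>

text \<open>Serves twice: for cochains on the group and for set functions with values in the unit
  interval.\<close>

lemma (in Metric_space) closure_of_product:
  assumes "A \<subseteq> I \<rightarrow>\<^sub>E M"
  shows "x \<in> product_topology (\<lambda>_. mtopology) I closure_of A \<longleftrightarrow>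
    x \<in> I \<rightarrow>\<^sub>E M \<and> (\<forall>S \<epsilon>. finite S \<and> S \<subseteq> I \<and> 0 < \<epsilon> \<longrightarrow> (\<exists>a\<in>A. \<forall>i\<in>S. d (a i) (x i) < \<epsilon>))"
    (is "?L \<longleftrightarrow> ?R")
proof
  assume L: ?L
  then have x: "x \<in> I \<rightarrow>\<^sub>E M" by (simp add: in_closure_of)
  have "\<exists>a\<in>A. \<forall>i\<in>S. d (a i) (x i) < \<epsilon>" if S: "finite S" "S \<subseteq> I" "0 < \<epsilon>" for S \<epsilon>
  proof -
    let ?U = "\<lambda>i. if i \<in> S then mball (x i) \<epsilon> else M"
    have "{i. ?U i \<noteq> topspace mtopology} \<subseteq> S" by auto
    then have "finite {i \<in> I. ?U i \<noteq> topspace mtopology}" using S finite_subset by fastforce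
    then have "openin (product_topology (\<lambda>_. mtopology) I) (PiE I ?U)"
      unfolding openin_PiE_gen by auto
    moreover have "x \<in> PiE I ?U" using x S by (auto simp: PiE_def Pi_def)
    ultimately obtain a where "a \<in> A" "a \<in> PiE I ?U" using L by (auto simp: in_closure_of)
    moreover have "d (a i) (x i) < \<epsilon>" if "i \<in> S" for i
      using PiE_mem[OF \<open>a \<in> PiE I ?U\<close>, of i] that S by (auto simp: commute)
    ultimately show ?thesis by blast
  qed
  with x show ?R by blast
next
  assume R: ?R
  have meets: "\<exists>a\<in>A. a \<in> W" if W: "x \<in> W" "openin (product_topology (\<lambda>_. mtopology) I) W" for W
  proof -
    have "\<exists>U. finite {i \<in> I. U i \<noteq> topspace mtopology} \<and> (\<forall>i\<in>I. openin mtopology (U i)) \<and>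
        x \<in> PiE I U \<and> PiE I U \<subseteq> W"
      using W(2)[unfolded openin_product_topology_alt] W(1) by (rule bspec)
    then obtain U where U: "finite {i \<in> I. U i \<noteq> topspace mtopology}" "\<forall>i\<in>I. openin mtopology (U i)"
      "x \<in> PiE I U" "PiE I U \<subseteq> W"
      by (elim exE conjE)
    let ?S = "{i \<in> I. U i \<noteq> M}"
    have fin: "finite ?S" using U(1) by simp
    have "\<forall>i\<in>?S. \<exists>r>0. mball (x i) r \<subseteq> U i"
      using U(2,3) by (auto simp: openin_mtopology dest: PiE_mem)
    then obtain r where r: "\<And>i. i \<in> ?S \<Longrightarrow> r i > 0 \<and> mball (x i) (r i) \<subseteq> U i" by metis
    \<comment> \<open>The 1 keeps \<open>Min\<close> meaningful if \<open>?S\<close> is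
      empty.\<close>
    define \<epsilon> where "\<epsilon> = Min (insert 1 (r ` ?S))"
    have "\<epsilon> > 0" unfolding \<epsilon>_def using r fin by (subst Min_gr_iff) auto
    have le: "\<epsilon> \<le> r i" if "i \<in> ?S" for i unfolding \<epsilon>_def using that fin by (intro Min_le) auto
    obtain a where a: "a \<in> A" "\<And>i. i \<in> ?S \<Longrightarrow> d (a i) (x i) < \<epsilon>"
      using R fin \<open>\<epsilon> > 0\<close> by (metis (no_types, lifting) mem_Collect_eq subsetI)
    have aM: "a \<in> I \<rightarrow>\<^sub>E M" using a assms by blast
    have "a i \<in> U i" if i: "i \<in> I" for i
    proof (cases "U i = M")
      case False
      then have "d (a i) (x i) < r i" using a(2)[of i] le[of i] i by simp
      then have "a i \<in> mball (x i) (r i)" using R aM i by (auto simp: commute dest: PiE_mem)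
      with r[of i] False i show ?thesis by blast
    qed (use aM i in auto)
    then have "a \<in> PiE I U" using aM by (auto simp: PiE_def)
    with U a show ?thesis by blast
  qed
  show ?L
    unfolding in_closure_of
  proof (intro conjI allI impI)
    show "x \<in> topspace (product_topology (\<lambda>_. mtopology) I)" using conjunct1[OF R] by simp
    fix W assume "x \<in> W \<and> openin (product_topology (\<lambda>_. mtopology) I) W"
    then show "\<exists>y. y \<in> A \<and> y \<in> W" using meets[of W] by (elim conjE) blast
  qed
qed

text \<open>Pointwise axioms on \<open>E\<close> instead of \<open>group_action\<close>, which
  demands extensional maps, while \<open>edge_action\<close> is given by \<open>map_prod\<close> on
  all pairs.\<close>

locale permutation_action = group G for G :: "('g, 'c) monoid_scheme" (structure) +
  fixes E :: "'e set" and \<psi> :: "'g \<Rightarrow> 'e \<Rightarrow> 'e"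
  assumes perm_closed: "\<lbrakk>g \<in> carrier G; e \<in> E\<rbrakk> \<Longrightarrow> \<psi> g e \<in> E"
    and perm_one: "e \<in> E \<Longrightarrow> \<psi> \<one> e = e"
    and perm_mult: "\<lbrakk>g \<in> carrier G; h \<in> carrier G; e \<in> E\<rbrakk> \<Longrightarrow> \<psi> (g \<otimes> h) e = \<psi> g (\<psi> h e)"
begin

abbreviation \<pi> where "\<pi> \<equiv> perm_rep G E \<psi>"

abbreviation closed_cob where "closed_cob \<equiv> closed_coboundaries G (ell2 E) (ell2_topology E) \<pi>"

lemma perm_bij: "g \<in> carrier G \<Longrightarrow> bij_betw (\<psi> g) E E"
  by (rule bij_betwI[where g = "\<psi> (inv g)"]) (auto simp: perm_closed perm_one simp flip: perm_mult)

lemma rep_norm: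
  assumes "g \<in> carrier G" shows "ell2_norm E (\<pi> g f) = ell2_norm E f"
proof -
  have "(ell2_norm E (\<pi> g f))\<^sup>2 = (ell2_norm E f)\<^sup>2"
    unfolding ell2_norm_square
    using infsum_reindex_bij_betw[OF perm_bij[OF inv_closed[OF assms]], of "\<lambda>e. (cmod (f e))\<^sup>2"]
    by (simp add: perm_rep_def cong: infsum_cong)
  then show ?thesis by (rule power2_eq_imp_eq) auto
qed

lemma rep_ell2:
  assumes "g \<in> carrier G" "f \<in> ell2 E" shows "\<pi> g f \<in> ell2 E"
proof -
  have "(\<lambda>e. (cmod (f (\<psi> (inv g) e)))\<^sup>2) summable_on E"
    using summable_on_reindex_bij_betw[OF perm_bij[OF inv_closed[OF assms(1)]], of "\<lambda>e. (cmod (f e))\<^sup>2"] assms(2)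
    by (simp add: ell2_def)
  then show ?thesis by (simp add: ell2_def perm_rep_def cong: summable_on_cong)
qed

lemma rep_add: "\<pi> g (f + h) = \<pi> g f + \<pi> g h"
  by (auto simp: perm_rep_def)

lemma rep_diff: "\<pi> g (f - h) = \<pi> g f - \<pi> g h"
  by (auto simp: perm_rep_def)

lemma rep_zero: "\<pi> g 0 = 0"
  by (auto simp: perm_rep_def)

lemma rep_uminus: "\<pi> g (- f) = - \<pi> g f"
  by (auto simp: perm_rep_def)

lemma rep_scale: "\<pi> g (\<lambda>e. c * f e) = (\<lambda>e. c * \<pi> g f e)"
  by (auto simp: perm_rep_def)

lemma rep_sum: "\<pi> g (\<Sum>i\<in>I. f i) = (\<Sum>i\<in>I. \<pi> g (f i))"
  by (induction I rule: infinite_finite_induct) (simp_all only: sum.infinite sum.empty sum.insert rep_zero rep_add not_False_eq_True)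

lemma rep_mult: "\<lbrakk>g \<in> carrier G; h \<in> carrier G\<rbrakk> \<Longrightarrow> \<pi> (g \<otimes> h) f = \<pi> g (\<pi> h f)"
  by (auto simp: perm_rep_def inv_mult_group perm_mult perm_closed)

lemma coboundaries_subset: "coboundaries G (ell2 E) \<pi> \<subseteq> cocycles G (ell2 E) \<pi>"
  using ell2_diff[OF rep_ell2] by (auto simp: coboundaries_def cocycles_def rep_mult rep_diff)

text \<open>Coboundaries are cocycles, so their closure in the subspace is the closure in the
  product cut down to cocycles; the rest is \<open>closure_of_product\<close>.\<close>

lemma closed_cob_iff:
  "c \<in> closed_cob \<longleftrightarrow> c \<in> cocycles G (ell2 E) \<pi> \<and>
    (\<forall>S \<epsilon>. finite S \<and> S \<subseteq> carrier G \<and> 0 < \<epsilon> \<longrightarrow>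
      (\<exists>v\<in>ell2 E. \<forall>g\<in>S. ell2_norm E (\<pi> g v - v - c g) < \<epsilon>))"
    (is "_ \<longleftrightarrow> ?rhs")
proof -
  let ?X = "product_topology (\<lambda>_. ell2_topology E) (carrier G)"
  have sub: "cocycles G (ell2 E) \<pi> \<subseteq> carrier G \<rightarrow>\<^sub>E ell2 E" by (auto simp: cocycles_def)
  have "cocycles G (ell2 E) \<pi> \<inter> coboundaries G (ell2 E) \<pi> = coboundaries G (ell2 E) \<pi>"
    using coboundaries_subset by blast
  then have "c \<in> closed_cob \<longleftrightarrow> c \<in> cocycles G (ell2 E) \<pi> \<and> c \<in> ?X closure_of coboundaries G (ell2 E) \<pi>"
    by (simp add: closed_coboundaries_def closure_of_subtopology)
  also have "\<dots> \<longleftrightarrow> c \<in> cocycles G (ell2 E) \<pi> \<and>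
      (\<forall>S \<epsilon>. finite S \<and> S \<subseteq> carrier G \<and> 0 < \<epsilon> \<longrightarrow>
        (\<exists>a\<in>coboundaries G (ell2 E) \<pi>. \<forall>g\<in>S. ell2_dist E (a g) (c g) < \<epsilon>))"
    unfolding Metric_space.closure_of_product[OF Metric_space_ell2 subset_trans[OF coboundaries_subset sub]]
    using subsetD[OF sub, of c] by (intro conj_cong refl) simp
  also have "\<dots> \<longleftrightarrow> ?rhs"
  proof -
    have img: "coboundaries G (ell2 E) \<pi> = (\<lambda>v. \<lambda>g\<in>carrier G. \<pi> g v - v) ` ell2 E"
      by (auto simp: coboundaries_def)
    have "(\<forall>g\<in>S. ell2_dist E ((\<lambda>g\<in>carrier G. \<pi> g v - v) g) (c g) < \<epsilon>) \<longleftrightarrow>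
        (\<forall>g\<in>S. ell2_norm E (\<pi> g v - v - c g) < \<epsilon>)" if "S \<subseteq> carrier G" for S v \<epsilon>
      using that by (intro ball_cong) (auto simp: ell2_dist_norm)
    then show ?thesis unfolding img bex_simps by (intro conj_cong all_cong refl) simp
  qed
  finally show ?thesis .
qed

lemma closed_cob_add:
  assumes "b \<in> closed_cob" "c \<in> closed_cob" shows "(\<lambda>g\<in>carrier G. b g + c g) \<in> closed_cob"
  unfolding closed_cob_iff
proof (intro conjI allI impI)
  have bc: "b \<in> cocycles G (ell2 E) \<pi>" "c \<in> cocycles G (ell2 E) \<pi>" using assms closed_cob_iff by blast+
  then have b2: "b g \<in> ell2 E" "c g \<in> ell2 E" if "g \<in> carrier G" for g
    using that by (auto simp: cocycles_def)
  then show "(\<lambda>g\<in>carrier G. b g + c g) \<in> cocycles G (ell2 E) \<pi>"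
    using bc by (auto simp: cocycles_def rep_add algebra_simps)
  fix S and \<epsilon> :: real assume S: "finite S \<and> S \<subseteq> carrier G \<and> 0 < \<epsilon>"
  then have half: "finite S \<and> S \<subseteq> carrier G \<and> 0 < \<epsilon> / 2" by simp
  obtain v where v: "v \<in> ell2 E" "\<And>g. g \<in> S \<Longrightarrow> ell2_norm E (\<pi> g v - v - b g) < \<epsilon> / 2"
    using assms(1) half unfolding closed_cob_iff by meson
  obtain w where w: "w \<in> ell2 E" "\<And>g. g \<in> S \<Longrightarrow> ell2_norm E (\<pi> g w - w - c g) < \<epsilon> / 2"
    using assms(2) half unfolding closed_cob_iff by meson
  have "ell2_norm E (\<pi> g (v + w) - (v + w) - (b g + c g)) < \<epsilon>" if g: "g \<in> S" for g
  proof -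
    have gG: "g \<in> carrier G" using g S by blast
    have "ell2_norm E ((\<pi> g v - v - b g) + (\<pi> g w - w - c g))
        \<le> ell2_norm E (\<pi> g v - v - b g) + ell2_norm E (\<pi> g w - w - c g)"
      using gG by (intro ell2_norm_triangle ell2_diff rep_ell2 v(1) w(1) b2)
    moreover have eq: "\<pi> g (v + w) - (v + w) - (b g + c g) = (\<pi> g v - v - b g) + (\<pi> g w - w - c g)"
      by (simp add: rep_add)
    ultimately show ?thesis unfolding eq using v(2)[OF g] w(2)[OF g] by linarith
  qed
  then show "\<exists>v\<in>ell2 E. \<forall>g\<in>S. ell2_norm E (\<pi> g v - v - (\<lambda>g\<in>carrier G. b g + c g) g) < \<epsilon>"
    using S by (intro bexI[of _ "v + w"] ell2_add v(1) w(1)) (auto simp: subset_iff)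
qed

lemma closed_cob_uminus:
  assumes "b \<in> closed_cob" shows "(\<lambda>g\<in>carrier G. - b g) \<in> closed_cob"
  unfolding closed_cob_iff
proof (intro conjI allI impI)
  have b: "b \<in> cocycles G (ell2 E) \<pi>" using assms closed_cob_iff by blast
  then show "(\<lambda>g\<in>carrier G. - b g) \<in> cocycles G (ell2 E) \<pi>"
    by (auto simp: cocycles_def rep_uminus)
  fix S and \<epsilon> :: real assume S: "finite S \<and> S \<subseteq> carrier G \<and> 0 < \<epsilon>"
  then obtain v where v: "v \<in> ell2 E" "\<And>g. g \<in> S \<Longrightarrow> ell2_norm E (\<pi> g v - v - b g) < \<epsilon>"
    using assms unfolding closed_cob_iff by meson
  have "ell2_norm E (\<pi> g (- v) - - v - - b g) = ell2_norm E (\<pi> g v - v - b g)" for g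
    using ell2_norm_uminus[of E "\<pi> g v - v - b g"] by (simp add: rep_uminus algebra_simps)
  then show "\<exists>v\<in>ell2 E. \<forall>g\<in>S. ell2_norm E (\<pi> g v - v - (\<lambda>g\<in>carrier G. - b g) g) < \<epsilon>"
    using v S by (intro bexI[of _ "- v"]) (auto simp: subset_iff)
qed

lemma closed_cob_zero: "(\<lambda>g\<in>carrier G. 0) \<in> closed_cob"
proof -
  have "(\<lambda>g\<in>carrier G. 0) \<in> cocycles G (ell2 E) \<pi>" by (auto simp: cocycles_def rep_zero)
  then show ?thesis
    unfolding closed_cob_iff by (auto intro!: bexI[of _ 0] simp: rep_zero subset_iff)
qed

text \<open>The unit of the quotient is the subgroup \<open>closed_cob\<close> itself. Adding
  \<open>c\<close> to the zero cocycle gives one direction, subtracting \<open>c\<close> from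
  members of \<open>closed_cob\<close> the other.\<close>

lemma reduced_class_trivial_iff:
  assumes c: "c \<in> cocycles G (ell2 E) \<pi>"
  shows "reduced_class G (ell2 E) (ell2_topology E) \<pi> c = \<one>\<^bsub>reduced_H1 G (ell2 E) (ell2_topology E) \<pi>\<^esub>
    \<longleftrightarrow> c \<in> closed_cob"
proof -
  have ext: "b \<in> extensional (carrier G)" if "b \<in> cocycles G (ell2 E) \<pi>" for b
    using that by (auto simp: cocycles_def PiE_def)
  have coset: "reduced_class G (ell2 E) (ell2_topology E) \<pi> c = (\<lambda>b. \<lambda>g\<in>carrier G. b g + c g) ` closed_cob"
    by (auto simp: reduced_class_def r_coset_def cocycle_group_def)
  have neutral: "\<one>\<^bsub>reduced_H1 G (ell2 E) (ell2_topology E) \<pi>\<^esub> = closed_cob"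
    by (simp add: reduced_H1_def FactGroup_def)
  show ?thesis
    unfolding coset neutral
  proof
    assume eq: "(\<lambda>b. \<lambda>g\<in>carrier G. b g + c g) ` closed_cob = closed_cob"
    have "(\<lambda>g\<in>carrier G. (\<lambda>g\<in>carrier G. 0) g + c g) \<in> closed_cob"
      by (subst eq[symmetric]) (rule imageI[OF closed_cob_zero])
    moreover have "(\<lambda>g\<in>carrier G. (\<lambda>g\<in>carrier G. 0) g + c g) = c"
      using ext[OF c] by (auto simp: fun_eq_iff extensional_def)
    ultimately show "c \<in> closed_cob" by (rule back_subst)
  next
    assume cc: "c \<in> closed_cob"
    show "(\<lambda>b. \<lambda>g\<in>carrier G. b g + c g) ` closed_cob = closed_cob"
    proof (intro equalityI subsetI)
      fix b assume b: "b \<in> closed_cob"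
      let ?d = "\<lambda>g\<in>carrier G. b g + (\<lambda>g\<in>carrier G. - c g) g"
      have "?d \<in> closed_cob" using b cc closed_cob_add closed_cob_uminus by blast
      moreover have "b = (\<lambda>g\<in>carrier G. ?d g + c g)"
        using ext[of b] b closed_cob_iff by (auto simp: fun_eq_iff extensional_def)
      ultimately show "b \<in> (\<lambda>b. \<lambda>g\<in>carrier G. b g + c g) ` closed_cob" by blast
    qed (use cc closed_cob_add in blast)
  qed
qed

end

section \<open>Almost invariant vectors\<close>

text \<open>The bounds are imposed on all sets, also those outside \<open>E\<close>, so that these
  functions lie in the cube of maps from sets to the unit interval, which is compact.\<close>

definition approximate_mean :: "'e set \<Rightarrow> ('g \<Rightarrow> 'e \<Rightarrow> 'e) \<Rightarrow> 'g set \<Rightarrow> real \<Rightarrow> ('e set \<Rightarrow> real) \<Rightarrow> bool" where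
  "approximate_mean E \<psi> S \<epsilon> \<mu> \<longleftrightarrow> (\<forall>A. 0 \<le> \<mu> A \<and> \<mu> A \<le> 1) \<and> \<mu> E = 1 \<and>
     (\<forall>A B. A \<subseteq> E \<longrightarrow> B \<subseteq> E \<longrightarrow> A \<inter> B = {} \<longrightarrow> \<mu> (A \<union> B) = \<mu> A + \<mu> B) \<and>
     (\<forall>g\<in>S. \<forall>A\<subseteq>E. \<bar>\<mu> (\<psi> g ` A) - \<mu> A\<bar> \<le> \<epsilon>)"

lemma approximate_mean_mono:
  "\<lbrakk>approximate_mean E \<psi> S \<epsilon> \<mu>; S' \<subseteq> S; \<epsilon> \<le> \<epsilon>'\<rbrakk> \<Longrightarrow> approximate_mean E \<psi> S' \<epsilon>' \<mu>"
  unfolding approximate_mean_def by (meson order_trans subsetD)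

text \<open>The closures of the sets of approximate means shrink as \<open>S\<close> grows and
  \<epsilon> decreases, so they have the finite intersection property in the compact cube; any
  common point serves as \<open>m\<close>.\<close>

lemma approximate_means_cluster:
  fixes E :: "'e set" and \<psi> :: "'g \<Rightarrow> 'e \<Rightarrow> 'e"
  assumes ex: "\<And>S \<epsilon>. \<lbrakk>finite S; S \<subseteq> C; 0 < \<epsilon>\<rbrakk> \<Longrightarrow> \<exists>\<mu>. approximate_mean E \<psi> S \<epsilon> \<mu>"
  obtains m :: "'e set \<Rightarrow> real" where "\<And>S \<epsilon> F. \<lbrakk>finite S; S \<subseteq> C; 0 < \<epsilon>; finite F\<rbrakk> \<Longrightarrow>
    \<exists>\<mu>. approximate_mean E \<psi> S \<epsilon> \<mu> \<and> (\<forall>A\<in>F. \<bar>\<mu> A - m A\<bar> < \<epsilon>)"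
proof -
  interpret I: Submetric UNIV dist "{0..1::real}"
    by unfold_locales auto
  define X where "X = product_topology (\<lambda>_::'e set. I.sub.mtopology) UNIV"
  have comp: "compact_space X"
    unfolding X_def compact_space_product_topology I.mtopology_submetric mtopology_is_euclidean
    by (simp add: compact_space_subtopology)
  define K where "K S \<epsilon> = X closure_of {\<mu>. approximate_mean E \<psi> S \<epsilon> \<mu>}" for S \<epsilon>
  define U where "U = {K S \<epsilon> | S \<epsilon>. finite S \<and> S \<subseteq> C \<and> 0 < \<epsilon>}"
  have sub: "{\<mu>. approximate_mean E \<psi> S \<epsilon> \<mu>} \<subseteq> UNIV \<rightarrow>\<^sub>E {0..1}" for S \<epsilon>
    by (auto simp: approximate_mean_def)
  have fip: "\<exists>S \<epsilon>. finite S \<and> S \<subseteq> C \<and> 0 < \<epsilon> \<and> K S \<epsilon> \<subseteq> \<Inter>F" if "finite F" "F \<subseteq> U" for F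
    using that
  proof (induction F rule: finite_induct)
    case empty
    show ?case by (intro exI[of _ "{}"] exI[of _ 1]) auto
  next
    case (insert L F)
    then obtain S \<epsilon> where S: "finite S" "S \<subseteq> C" "0 < \<epsilon>" "K S \<epsilon> \<subseteq> \<Inter>F" by auto
    obtain S' \<epsilon>' where S': "finite S'" "S' \<subseteq> C" "0 < \<epsilon>'" "L = K S' \<epsilon>'"
      using insert by (auto simp: U_def)
    have "K (S \<union> S') (min \<epsilon> \<epsilon>') \<subseteq> K S \<epsilon>" "K (S \<union> S') (min \<epsilon> \<epsilon>') \<subseteq> K S' \<epsilon>'"
      unfolding K_def by (intro closure_of_mono Collect_mono impI; erule approximate_mean_mono; simp)+
    then have "K (S \<union> S') (min \<epsilon> \<epsilon>') \<subseteq> \<Inter>(insert L F)" using S(4) S'(4) by auto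
    then show ?case using S S' by (intro exI[of _ "S \<union> S'"] exI[of _ "min \<epsilon> \<epsilon>'"]) auto
  qed
  have "\<Inter>F \<noteq> {}" if F: "finite F" "F \<subseteq> U" for F
  proof -
    obtain S \<epsilon> where S: "finite S" "S \<subseteq> C" "0 < \<epsilon>" "K S \<epsilon> \<subseteq> \<Inter>F" using fip[OF F] by auto
    then obtain \<mu> where "approximate_mean E \<psi> S \<epsilon> \<mu>" using ex by blast
    moreover have "{\<mu>. approximate_mean E \<psi> S \<epsilon> \<mu>} \<subseteq> K S \<epsilon>"
      unfolding K_def X_def using sub by (intro closure_of_subset) simp
    ultimately show ?thesis using S(4) by blast
  qed
  moreover have "\<forall>L\<in>U. closedin X L" by (auto simp: U_def K_def)
  ultimately have "\<Inter>U \<noteq> {}"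
    using comp[unfolded compact_space_fip, rule_format, of U] by simp
  then obtain m where m: "m \<in> \<Inter>U" by blast
  show thesis
  proof (rule that)
    fix S and \<epsilon> :: real and F :: "'e set set" assume S: "finite S" "S \<subseteq> C" "0 < \<epsilon>" "finite F"
    then have "m \<in> K S \<epsilon>" using m by (auto simp: U_def)
    then have "\<forall>F \<delta>. finite F \<and> F \<subseteq> UNIV \<and> 0 < \<delta> \<longrightarrow>
        (\<exists>\<mu>\<in>{\<mu>. approximate_mean E \<psi> S \<epsilon> \<mu>}. \<forall>A\<in>F. dist (\<mu> A) (m A) < \<delta>)"
      unfolding K_def X_def I.sub.closure_of_product[OF sub] by (rule conjunct2)
    from this[rule_format, of F \<epsilon>] show "\<exists>\<mu>. approximate_mean E \<psi> S \<epsilon> \<mu> \<and> (\<forall>A\<in>F. \<bar>\<mu> A - m A\<bar> < \<epsilon>)"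
      using S by (simp add: dist_real_def)
  qed
qed

lemma mean_exists:
  fixes E :: "'e set" and \<psi> :: "'g \<Rightarrow> 'e \<Rightarrow> 'e"
  assumes ex: "\<And>S \<epsilon>. \<lbrakk>finite S; S \<subseteq> C; 0 < \<epsilon>\<rbrakk> \<Longrightarrow> \<exists>\<mu>. approximate_mean E \<psi> S \<epsilon> \<mu>"
  obtains m :: "'e set \<Rightarrow> real" where "m E = 1" "\<And>A. 0 \<le> m A"
    "\<And>A B. \<lbrakk>A \<subseteq> E; B \<subseteq> E; A \<inter> B = {}\<rbrakk> \<Longrightarrow> m (A \<union> B) = m A + m B"
    "\<And>g A. \<lbrakk>g \<in> C; A \<subseteq> E\<rbrakk> \<Longrightarrow> m (\<psi> g ` A) = m A"
proof -
  obtain m where m: "\<And>S \<epsilon> F. \<lbrakk>finite S; S \<subseteq> C; 0 < \<epsilon>; finite F\<rbrakk> \<Longrightarrow>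
      \<exists>\<mu>. approximate_mean E \<psi> S \<epsilon> \<mu> \<and> (\<forall>A\<in>F. \<bar>\<mu> A - m A\<bar> < \<epsilon>)"
    using approximate_means_cluster[OF ex] by blast
  \<comment> \<open>At most three errors of size \<epsilon> add up in each identity: three values of
    \<open>m\<close> for additivity, two values and the tolerance of \<mu> for invariance.\<close>
  have zero: "x = 0" if "\<And>\<epsilon>. \<epsilon> > 0 \<Longrightarrow> \<bar>x\<bar> \<le> 3 * \<epsilon>" for x :: real
    using that[of "\<bar>x\<bar> / 6"] by (cases "x = 0") auto
  show thesis
  proof (rule that)
    have "m E - 1 = 0"
    proof (rule zero)
      fix \<epsilon> :: real assume "\<epsilon> > 0"
      then obtain \<mu> where "approximate_mean E \<psi> {} \<epsilon> \<mu>" "\<bar>\<mu> E - m E\<bar> < \<epsilon>"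
        using m[of "{}" \<epsilon> "{E}"] by auto
      then show "\<bar>m E - 1\<bar> \<le> 3 * \<epsilon>" by (simp add: approximate_mean_def)
    qed
    then show "m E = 1" by simp
    show "0 \<le> m A" for A
    proof (rule field_le_epsilon)
      fix \<epsilon> :: real assume "\<epsilon> > 0"
      then obtain \<mu> where "approximate_mean E \<psi> {} \<epsilon> \<mu>" "\<bar>\<mu> A - m A\<bar> < \<epsilon>"
        using m[of "{}" \<epsilon> "{A}"] by auto
      moreover from this(1) have "0 \<le> \<mu> A" by (simp add: approximate_mean_def)
      ultimately show "0 \<le> m A + \<epsilon>" by linarith
    qed
    show "m (A \<union> B) = m A + m B" if AB: "A \<subseteq> E" "B \<subseteq> E" "A \<inter> B = {}" for A B
    proof -
      have "m (A \<union> B) - (m A + m B) = 0"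
      proof (rule zero)
        fix \<epsilon> :: real assume "\<epsilon> > 0"
        then obtain \<mu> where \<mu>: "approximate_mean E \<psi> {} \<epsilon> \<mu>" "\<bar>\<mu> A - m A\<bar> < \<epsilon>" "\<bar>\<mu> B - m B\<bar> < \<epsilon>"
            "\<bar>\<mu> (A \<union> B) - m (A \<union> B)\<bar> < \<epsilon>"
          using m[of "{}" \<epsilon> "{A, B, A \<union> B}"] by auto
        moreover have "\<mu> (A \<union> B) = \<mu> A + \<mu> B" using \<mu>(1) AB by (simp add: approximate_mean_def)
        ultimately show "\<bar>m (A \<union> B) - (m A + m B)\<bar> \<le> 3 * \<epsilon>" by linarith
      qed
      then show ?thesis by simp
    qed
    show "m (\<psi> g ` A) = m A" if g: "g \<in> C" "A \<subseteq> E" for g A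
    proof -
      have "m (\<psi> g ` A) - m A = 0"
      proof (rule zero)
        fix \<epsilon> :: real assume "\<epsilon> > 0"
        then obtain \<mu> where \<mu>: "approximate_mean E \<psi> {g} \<epsilon> \<mu>" "\<bar>\<mu> A - m A\<bar> < \<epsilon>" "\<bar>\<mu> (\<psi> g ` A) - m (\<psi> g ` A)\<bar> < \<epsilon>"
          using m[of "{g}" \<epsilon> "{A, \<psi> g ` A}"] g by auto
        moreover have "\<bar>\<mu> (\<psi> g ` A) - \<mu> A\<bar> \<le> \<epsilon>" using \<mu>(1) g by (simp add: approximate_mean_def)
        ultimately show "\<bar>m (\<psi> g ` A) - m A\<bar> \<le> 3 * \<epsilon>" by linarith
      qed
      then show ?thesis by simp
    qed
  qed
qed

section \<open>The mass distribution of a square-summable function\<close>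

definition trim :: "'e set \<Rightarrow> ('e \<Rightarrow> complex) \<Rightarrow> 'e \<Rightarrow> complex" where
  "trim A f = (\<lambda>e. if e \<in> A then f e else 0)"

lemma trim_ell2:
  assumes "f \<in> ell2 E" shows "trim A f \<in> ell2 E"
proof -
  have "(\<lambda>e. (cmod (trim A f e))\<^sup>2) summable_on E"
  proof (rule summable_on_comparison_test)
    show "(\<lambda>e. (cmod (f e))\<^sup>2) summable_on E" using assms by (simp add: ell2_def)
  qed (auto simp: trim_def)
  then show ?thesis using assms by (simp add: ell2_def trim_def)
qed

lemma trim_norm_le:
  assumes "f \<in> ell2 E" shows "ell2_norm E (trim A f) \<le> ell2_norm E f"
proof -
  have "(ell2_norm E (trim A f))\<^sup>2 \<le> (ell2_norm E f)\<^sup>2"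
    unfolding ell2_norm_square using assms trim_ell2[OF assms, of A]
    by (intro infsum_mono) (auto simp: ell2_def trim_def)
  then show ?thesis by (rule power2_le_imp_le) simp
qed

lemma trim_union_norm:
  assumes "f \<in> ell2 E" "A \<inter> B = {}"
  shows "(ell2_norm E (trim (A \<union> B) f))\<^sup>2 = (ell2_norm E (trim A f))\<^sup>2 + (ell2_norm E (trim B f))\<^sup>2"
proof -
  have "(\<Sum>\<^sub>\<infinity>e\<in>E. (cmod (trim A f e))\<^sup>2) + (\<Sum>\<^sub>\<infinity>e\<in>E. (cmod (trim B f e))\<^sup>2)
      = (\<Sum>\<^sub>\<infinity>e\<in>E. (cmod (trim A f e))\<^sup>2 + (cmod (trim B f e))\<^sup>2)"
    using trim_ell2[OF assms(1)] by (intro infsum_add[symmetric]) (auto simp: ell2_def)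
  also have "\<dots> = (\<Sum>\<^sub>\<infinity>e\<in>E. (cmod (trim (A \<union> B) f e))\<^sup>2)"
    using assms(2) by (intro infsum_cong) (auto simp: trim_def)
  finally show ?thesis by (simp add: ell2_norm_square)
qed

text \<open>Difference of two squares: restriction is linear and does not increase norms, so one
  factor is at most the distance of the vectors and the other at most twice their common
  norm.\<close>

lemma trim_norm_square_diff:
  assumes "f \<in> ell2 E" "h \<in> ell2 E" "ell2_norm E h = ell2_norm E f"
  shows "\<bar>(ell2_norm E (trim A h))\<^sup>2 - (ell2_norm E (trim A f))\<^sup>2\<bar> \<le> 2 * ell2_norm E f * ell2_norm E (h - f)"
proof -
  let ?n = "ell2_norm E"
  have trim_diff: "trim A (u - w) = trim A u - trim A w" for u w by (auto simp: trim_def)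
  have tri: "?n (trim A u) - ?n (trim A w) \<le> ?n (u - w)" if "u \<in> ell2 E" "w \<in> ell2 E" for u w
  proof -
    have "?n (trim A w + trim A (u - w)) \<le> ?n (trim A w) + ?n (trim A (u - w))"
      using that by (intro ell2_norm_triangle trim_ell2 ell2_diff)
    moreover have "trim A w + trim A (u - w) = trim A u" by (simp add: trim_diff)
    moreover have "?n (trim A (u - w)) \<le> ?n (u - w)" using that by (intro trim_norm_le ell2_diff)
    ultimately show ?thesis by simp
  qed
  have d: "\<bar>?n (trim A h) - ?n (trim A f)\<bar> \<le> ?n (h - f)"
    using tri[OF assms(1,2)] tri[OF assms(2,1)] ell2_norm_minus_commute[of E f h] by linarith
  have "\<bar>(?n (trim A h))\<^sup>2 - (?n (trim A f))\<^sup>2\<bar> = (?n (trim A h) + ?n (trim A f)) * \<bar>?n (trim A h) - ?n (trim A f)\<bar>"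
    by (simp add: power2_eq_square square_diff_square_factored abs_mult)
  also have "\<dots> \<le> (2 * ?n f) * ?n (h - f)"
    using d trim_norm_le[OF assms(1), of A] trim_norm_le[OF assms(2), of A] assms(3)
    by (intro mult_mono) auto
  finally show ?thesis .
qed

context permutation_action
begin

lemma rep_inv_norm:
  assumes "g \<in> carrier G" "v \<in> ell2 E"
  shows "ell2_norm E (\<pi> (inv g) v - v) = ell2_norm E (\<pi> g v - v)"
proof -
  have "\<pi> \<one> v = v" using assms(2) by (auto simp: perm_rep_def perm_one ell2_def)
  then have "\<pi> g (\<pi> (inv g) v - v) = v - \<pi> g v"
    using rep_mult[of g "inv g" v] assms(1) by (simp add: rep_diff)
  then show ?thesis using rep_norm[OF assms(1), of "\<pi> (inv g) v - v"] ell2_norm_minus_commute[of E v] by simp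
qed

text \<open>Turns the translation of a set into a translation of the vector, so that near invariance
  of \<open>v\<close> becomes near invariance of its mass distribution.\<close>

lemma trim_rep:
  assumes "g \<in> carrier G" "A \<subseteq> E"
  shows "ell2_norm E (trim A (\<pi> (inv g) v)) = ell2_norm E (trim (\<psi> g ` A) v)"
proof -
  have "e \<in> A \<longleftrightarrow> \<psi> g e \<in> \<psi> g ` A" if "e \<in> E" for e
    using perm_bij[OF assms(1)] that assms(2) by (auto simp: bij_betw_def inj_on_def)
  then have "trim A (\<pi> (inv g) v) = \<pi> (inv g) (trim (\<psi> g ` A) v)"
    using assms by (auto simp: trim_def perm_rep_def)
  then show ?thesis using rep_norm[OF inv_closed[OF assms(1)]] by simp
qed

text \<open>The mean has the normalised squared modulus of \<open>v\<close> as density. The factor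
  1/2 in the hypothesis cancels the 2 of \<open>trim_norm_square_diff\<close>.\<close>

lemma approximate_mean_of_vector:
  assumes v: "v \<in> ell2 E" "v \<noteq> 0" and S: "S \<subseteq> carrier G"
    and inv: "\<And>g. g \<in> S \<Longrightarrow> ell2_norm E (\<pi> g v - v) < \<epsilon> / 2 * ell2_norm E v"
  shows "approximate_mean E \<psi> S \<epsilon> (\<lambda>A. (ell2_norm E (trim A v))\<^sup>2 / (ell2_norm E v)\<^sup>2)"
proof -
  let ?n = "ell2_norm E"
  have pos: "?n v > 0" using ell2_norm_eq_0[OF v(1)] v(2) ell2_norm_nonneg[of E v] by linarith
  have "trim E v = v" using v(1) by (auto simp: trim_def ell2_def)
  moreover have "(?n (trim A v))\<^sup>2 / (?n v)\<^sup>2 \<le> 1" for A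
    using trim_norm_le[OF v(1), of A] pos by (simp add: power_mono)
  moreover have "\<bar>(?n (trim (\<psi> g ` A) v))\<^sup>2 / (?n v)\<^sup>2 - (?n (trim A v))\<^sup>2 / (?n v)\<^sup>2\<bar> \<le> \<epsilon>"
    if g: "g \<in> S" and A: "A \<subseteq> E" for g A
  proof -
    have gG: "g \<in> carrier G" using g S by blast
    have "\<bar>(?n (trim A (\<pi> (inv g) v)))\<^sup>2 - (?n (trim A v))\<^sup>2\<bar> \<le> 2 * ?n v * ?n (\<pi> (inv g) v - v)"
      using gG v by (intro trim_norm_square_diff rep_ell2 rep_norm inv_closed)
    also have "\<dots> = 2 * ?n v * ?n (\<pi> g v - v)" using rep_inv_norm[OF gG v(1)] by simp
    also have "\<dots> \<le> 2 * ?n v * (\<epsilon> / 2 * ?n v)" using inv[OF g] pos by (intro mult_left_mono) auto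
    also have "\<dots> = \<epsilon> * (?n v)\<^sup>2" by (simp add: power2_eq_square)
    finally have "\<bar>(?n (trim (\<psi> g ` A) v))\<^sup>2 - (?n (trim A v))\<^sup>2\<bar> \<le> \<epsilon> * (?n v)\<^sup>2"
      using trim_rep[OF gG A] by simp
    then show ?thesis using pos
      by (simp add: divide_le_eq flip: diff_divide_distrib)
  qed
  ultimately show ?thesis
    using pos trim_union_norm[OF v(1)] unfolding approximate_mean_def
    by (simp add: add_divide_distrib)
qed

lemma invariant_mean_if_almost_invariant:
  assumes "\<And>S \<epsilon>. \<lbrakk>finite S; S \<subseteq> carrier G; 0 < \<epsilon>\<rbrakk> \<Longrightarrow>
    \<exists>v\<in>ell2 E. v \<noteq> 0 \<and> (\<forall>g\<in>S. ell2_norm E (\<pi> g v - v) < \<epsilon> * ell2_norm E v)"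
  obtains m :: "'e set \<Rightarrow> real" where "m E = 1" "\<And>A. 0 \<le> m A"
    "\<And>A B. \<lbrakk>A \<subseteq> E; B \<subseteq> E; A \<inter> B = {}\<rbrakk> \<Longrightarrow> m (A \<union> B) = m A + m B"
    "\<And>g A. \<lbrakk>g \<in> carrier G; A \<subseteq> E\<rbrakk> \<Longrightarrow> m (\<psi> g ` A) = m A"
proof (rule mean_exists)
  fix S and \<epsilon> :: real assume S: "finite S" "S \<subseteq> carrier G" "0 < \<epsilon>"
  then obtain v where "v \<in> ell2 E" "v \<noteq> 0" "\<forall>g\<in>S. ell2_norm E (\<pi> g v - v) < \<epsilon> / 2 * ell2_norm E v"
    using assms[of S "\<epsilon> / 2"] by auto
  then show "\<exists>\<mu>. approximate_mean E \<psi> S \<epsilon> \<mu>"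
    using approximate_mean_of_vector S(2) by blast
qed (rule that)

text \<open>For each \<open>g\<close>, some vector \<open>v\<close> has a coboundary within 1 of
  \<open>c\<close> on \<open>S\<close> and at \<open>g\<close>. The gap on \<open>S\<close> bounds
  the norm of \<open>v\<close> by a constant that does not depend on \<open>g\<close>, and the
  coboundary of \<open>v\<close> at \<open>g\<close> has at most twice the norm of
  \<open>v\<close>.\<close>

lemma closed_cob_bounded:
  assumes c: "c \<in> closed_cob" and S: "finite S" "S \<subseteq> carrier G" and "0 < \<epsilon>"
    and gap: "\<And>v. \<lbrakk>v \<in> ell2 E; v \<noteq> 0\<rbrakk> \<Longrightarrow> \<exists>g\<in>S. \<epsilon> * ell2_norm E v \<le> ell2_norm E (\<pi> g v - v)"
  obtains B where "\<And>g. g \<in> carrier G \<Longrightarrow> ell2_norm E (c g) \<le> B"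
proof (rule that)
  let ?n = "ell2_norm E"
  let ?K = "(\<Sum>s\<in>S. ?n (c s)) + 1"
  fix g assume g: "g \<in> carrier G"
  have cl: "c h \<in> ell2 E" if "h \<in> carrier G" for h
    using c that unfolding closed_cob_iff cocycles_def by auto
  have "finite (insert g S) \<and> insert g S \<subseteq> carrier G \<and> (0::real) < 1" using S g by simp
  then obtain v where v: "v \<in> ell2 E" "\<And>h. h \<in> insert g S \<Longrightarrow> ?n (\<pi> h v - v - c h) < 1"
    using c unfolding closed_cob_iff by meson
  have "\<epsilon> * ?n v \<le> ?K"
  proof (cases "v = 0")
    case False
    then obtain s where s: "s \<in> S" "\<epsilon> * ?n v \<le> ?n (\<pi> s v - v)" using gap v(1) by blast
    then have sG: "s \<in> carrier G" using S by blast
    have "?n ((\<pi> s v - v - c s) + c s) \<le> ?n (\<pi> s v - v - c s) + ?n (c s)"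
      using sG by (intro ell2_norm_triangle ell2_diff rep_ell2 v(1) cl)
    moreover have "?n (c s) \<le> (\<Sum>s\<in>S. ?n (c s))" using s S by (intro member_le_sum) auto
    ultimately show ?thesis using s(2) v(2)[of s] s(1) by simp
  qed (simp add: sum_nonneg)
  then have nv: "?n v \<le> ?K / \<epsilon>" using \<open>0 < \<epsilon>\<close> by (simp add: le_divide_eq mult.commute)
  have "?n ((\<pi> g v - v) - (\<pi> g v - v - c g)) \<le> ?n (\<pi> g v - v) + ?n (\<pi> g v - v - c g)"
    using g by (intro ell2_norm_triangle_diff ell2_diff rep_ell2 v(1) cl)
  moreover have "?n (\<pi> g v - v) \<le> ?n (\<pi> g v) + ?n v"
    using g by (intro ell2_norm_triangle_diff rep_ell2 v(1))
  moreover have eq: "(\<pi> g v - v) - (\<pi> g v - v - c g) = c g" by simp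
  moreover have "?n (\<pi> g v - v - c g) < 1" using v(2) by blast
  ultimately show "?n (c g) \<le> 2 * (?K / \<epsilon>) + 1"
    using nv unfolding rep_norm[OF g, of v] eq by linarith
qed

end

section \<open>The Haagerup cocycle\<close>

lemma sum_fun_apply: "(\<Sum>i\<in>I. f i) e = (\<Sum>i\<in>I. f i e)" for f :: "'i \<Rightarrow> 'e \<Rightarrow> complex"
  by (induction I rule: infinite_finite_induct) simp_all

lemma ell2_finite_support:
  assumes "finite A" "A \<subseteq> E" "\<And>e. e \<notin> A \<Longrightarrow> f e = 0"
  shows "f \<in> ell2 E" "(ell2_norm E f)\<^sup>2 = (\<Sum>e\<in>A. (cmod (f e))\<^sup>2)"
proof -
  have "(\<lambda>e. (cmod (f e))\<^sup>2) summable_on E \<longleftrightarrow> (\<lambda>e. (cmod (f e))\<^sup>2) summable_on A"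
    using assms by (intro summable_on_cong_neutral) auto
  then show "f \<in> ell2 E" using assms by (auto simp: ell2_def)
  have "(\<Sum>\<^sub>\<infinity>e\<in>E. (cmod (f e))\<^sup>2) = (\<Sum>\<^sub>\<infinity>e\<in>A. (cmod (f e))\<^sup>2)"
    using assms by (intro infsum_cong_neutral) auto
  then show "(ell2_norm E f)\<^sup>2 = (\<Sum>e\<in>A. (cmod (f e))\<^sup>2)"
    using assms by (simp add: ell2_norm_square)
qed

context tree_graph
begin

abbreviation ind :: "'v \<Rightarrow> 'v \<times> 'v \<Rightarrow> complex" where
  "ind \<equiv> towards_indicator T"

lemma ind_half:
  assumes "x \<in> V" shows "ind x h = (if h \<in> E \<and> x \<in> half (fst h) (snd h) then 1 else 0)"
proof -
  have "points_towards T h x \<longleftrightarrow> x \<in> half (fst h) (snd h)" if "h \<in> E"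
    using that assms arc_fst_in_verts arc_snd_in_verts
    by (simp add: points_towards_def half_def tree_dist_eq)
  then show ?thesis by (auto simp: towards_indicator_def indicator_def)
qed

text \<open>The difference is 1 on the separating edges that point towards \<open>p\<close>, -1 on
  their reversals and 0 elsewhere; hence the factor 2.\<close>

lemma ind_diff:
  assumes "p \<in> V" "q \<in> V"
  shows "ind p - ind q \<in> ell2 E" "(ell2_norm E (ind p - ind q))\<^sup>2 = 2 * real (vd p q)"
proof -
  define A where "A p q = {h \<in> E. p \<in> half (fst h) (snd h) \<and> q \<notin> half (fst h) (snd h)}" for p q
  have A: "finite (A p q)" "card (A p q) = vd p q" "finite (A q p)" "card (A q p) = vd p q"
    using separating_edges assms vd_sym[of p q] unfolding A_def by auto
  have sub: "A p q \<union> A q p \<subseteq> E" by (auto simp: A_def)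
  have zero: "(ind p - ind q) e = 0" if "e \<notin> A p q \<union> A q p" for e
    using that by (auto simp: A_def ind_half assms)
  have one: "(cmod ((ind p - ind q) e))\<^sup>2 = 1" if "e \<in> A p q \<union> A q p" for e
    using that by (auto simp: A_def ind_half assms)
  show "ind p - ind q \<in> ell2 E" using ell2_finite_support(1)[where f = "ind p - ind q", OF _ sub zero] A by simp
  have "(ell2_norm E (ind p - ind q))\<^sup>2 = (\<Sum>e\<in>A p q \<union> A q p. (cmod ((ind p - ind q) e))\<^sup>2)"
    using A by (intro ell2_finite_support(2)[where f = "ind p - ind q", OF _ sub zero]) auto
  also have "\<dots> = real (card (A p q \<union> A q p))" using one by simp
  also have "card (A p q \<union> A q p) = card (A p q) + card (A q p)"
    using A by (intro card_Un_disjoint) (auto simp: A_def)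
  finally show "(ell2_norm E (ind p - ind q))\<^sup>2 = 2 * real (vd p q)" using A by (simp add: fun_diff_def)
qed

lemma ind_diff_norm_le:
  assumes "p \<in> V" "q \<in> V" "vd p q \<le> n" shows "ell2_norm E (ind p - ind q) \<le> sqrt (2 * real n)"
  by (rule real_le_rsqrt) (use ind_diff(2)[OF assms(1,2)] assms(3) in simp)

text \<open>Passing from shift \<open>t\<close> to \<open>Suc t\<close> changes the sum by a
  telescoping sum, of which only two vertices at distance at most \<open>N\<close> remain. The
  inequality in the hypothesis admits constant sequences along with rays.\<close>

lemma shifted_average_norm:
  assumes "\<And>k. s k \<in> V" "\<And>a k. vd (s a) (s (a + k)) \<le> k"
  shows "(\<Sum>k<N. ind (s k) - ind (s (k + t))) \<in> ell2 E \<and>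
    ell2_norm E (\<Sum>k<N. ind (s k) - ind (s (k + t))) \<le> real t * sqrt (2 * real N)"
proof (induction t)
  case 0
  have "(\<Sum>k<N. ind (s k) - ind (s (k + 0))) = 0"
    by (intro sum.neutral) (simp add: zero_fun_def)
  then show ?case by (simp only: ell2_zero ell2_norm_zero) simp
next
  case (Suc t)
  let ?D = "\<lambda>t. \<Sum>k<N. ind (s k) - ind (s (k + t))"
  have "?D (Suc t) = ?D t + (\<Sum>k<N. ind (s (k + t)) - ind (s (Suc k + t)))"
    by (simp add: sum_subtractf)
  also have "(\<Sum>k<N. ind (s (k + t)) - ind (s (Suc k + t))) = ind (s t) - ind (s (t + N))"
    using sum_lessThan_telescope'[of "\<lambda>k. ind (s (k + t))" N] by (simp add: add.commute)
  finally have eq: "?D (Suc t) = ?D t + (ind (s t) - ind (s (t + N)))" .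
  have e: "ind (s t) - ind (s (t + N)) \<in> ell2 E" using assms(1) by (intro ind_diff)
  have "ell2_norm E (?D t + (ind (s t) - ind (s (t + N)))) \<le> ell2_norm E (?D t) + ell2_norm E (ind (s t) - ind (s (t + N)))"
    by (intro ell2_norm_triangle conjunct1[OF Suc] e)
  moreover have "ell2_norm E (ind (s t) - ind (s (t + N))) \<le> sqrt (2 * real N)"
    using assms by (intro ind_diff_norm_le)
  ultimately have "ell2_norm E (?D t + (ind (s t) - ind (s (t + N)))) \<le> real (Suc t) * sqrt (2 * real N)"
    using conjunct2[OF Suc] unfolding of_nat_Suc distrib_right by linarith
  then show ?case
    unfolding eq using ell2_add[OF conjunct1[OF Suc] e] by (rule conjI[rotated])
qed

end

context acting_on_tree
begin

sublocale perm: permutation_action G E "edge_action \<phi>"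
proof
  show "edge_action \<phi> g e \<in> E" if "g \<in> carrier G" "e \<in> E" for g e
    using that act_edge by (cases e) (auto simp: edge_action_def)
  show "edge_action \<phi> \<one> e = e" if "e \<in> E" for e
    using that edge_V by (cases e) (auto simp: edge_action_def)
  show "edge_action \<phi> (g \<otimes> h) e = edge_action \<phi> g (edge_action \<phi> h e)"
    if "g \<in> carrier G" "h \<in> carrier G" "e \<in> E" for g h e
    using that edge_V composition_rule by (cases e) (auto simp: edge_action_def)
qed

lemma rep_ind:
  assumes "g \<in> carrier G" "x \<in> V" shows "perm.\<pi> g (ind x) = ind (\<phi> g x)"
proof
  fix h
  show "perm.\<pi> g (ind x) h = ind (\<phi> g x) h"
  proof (cases "h \<in> E")
    case True
    obtain u w where h: "h = (u, w)" by (cases h)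
    have V: "u \<in> V" "w \<in> V" using True h edge_V by blast+
    have "x \<in> half (\<phi> (inv g) u) (\<phi> (inv g) w) \<longleftrightarrow> \<phi> g x \<in> half u w"
      using act_half_iff[of "inv g" u w "\<phi> g x"] assms V act_inv by simp
    moreover have "edge_action \<phi> (inv g) h \<in> E" using perm.perm_closed True assms by simp
    ultimately show ?thesis
      using True assms by (simp add: perm_rep_def ind_half edge_action_def h)
  next
    case False
    then show ?thesis using assms by (simp add: perm_rep_def ind_half)
  qed
qed

lemma haagerup_cocycle:
  assumes "x \<in> V" shows "haagerup_cocycle G T \<phi> x \<in> cocycles G (ell2 E) perm.\<pi>"
proof -
  have "ind (\<phi> (g \<otimes> h) x) - ind x = ind (\<phi> g x) - ind x + perm.\<pi> g (ind (\<phi> h x) - ind x)"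
    if "g \<in> carrier G" "h \<in> carrier G" for g h
    using that assms by (simp add: perm.rep_diff rep_ind composition_rule)
  then show ?thesis
    using assms ind_diff(1) by (auto simp: cocycles_def haagerup_cocycle_def)
qed

theorem elementary_if_trivial:
  assumes x: "x \<in> V" and triv: "haagerup_cocycle G T \<phi> x \<in> perm.closed_cob"
  shows "elementary_action G T \<phi>"
proof (cases "\<exists>S \<epsilon>. finite S \<and> S \<subseteq> carrier G \<and> 0 < \<epsilon> \<and>
    (\<forall>v\<in>ell2 E. v \<noteq> 0 \<longrightarrow> (\<exists>g\<in>S. \<epsilon> * ell2_norm E v \<le> ell2_norm E (perm.\<pi> g v - v)))")
  case True
  then obtain S and \<epsilon> :: real where S: "finite S" "S \<subseteq> carrier G" "0 < \<epsilon>"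
    "\<And>v. \<lbrakk>v \<in> ell2 E; v \<noteq> 0\<rbrakk> \<Longrightarrow> \<exists>g\<in>S. \<epsilon> * ell2_norm E v \<le> ell2_norm E (perm.\<pi> g v - v)" by blast
  obtain B where B: "\<And>g. g \<in> carrier G \<Longrightarrow> ell2_norm E (haagerup_cocycle G T \<phi> x g) \<le> B"
    using perm.closed_cob_bounded[OF triv S] by blast
  have "vd (\<phi> g x) x \<le> nat \<lceil>B\<^sup>2\<rceil>" if g: "g \<in> carrier G" for g
  proof -
    have "2 * real (vd (\<phi> g x) x) = (ell2_norm E (ind (\<phi> g x) - ind x))\<^sup>2"
      using ind_diff(2)[of "\<phi> g x" x] g x by simp
    also have "\<dots> \<le> B\<^sup>2" using B[OF g] g by (intro power_mono) (auto simp: haagerup_cocycle_def)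
    finally have "real (vd (\<phi> g x) x) \<le> B\<^sup>2" by simp
    then show ?thesis by linarith
  qed
  then show ?thesis using elementary_bounded[OF x] by blast
next
  case False
  then have almost: "\<exists>v\<in>ell2 E. v \<noteq> 0 \<and> (\<forall>g\<in>S. ell2_norm E (perm.\<pi> g v - v) < \<epsilon> * ell2_norm E v)"
    if "finite S" "S \<subseteq> carrier G" "0 < \<epsilon>" for S \<epsilon>
    using that by (meson not_le)
  obtain m :: "('v \<times> 'v) set \<Rightarrow> real" where m: "m E = 1" "\<And>A. 0 \<le> m A"
    "\<And>A B. \<lbrakk>A \<subseteq> E; B \<subseteq> E; A \<inter> B = {}\<rbrakk> \<Longrightarrow> m (A \<union> B) = m A + m B"
    "\<And>g A. \<lbrakk>g \<in> carrier G; A \<subseteq> E\<rbrakk> \<Longrightarrow> m (edge_action \<phi> g ` A) = m A"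
    using perm.invariant_mean_if_almost_invariant[OF almost] by blast
  \<comment> \<open>The mean on oriented edges is pushed forward to the vertices by the initial
    vertex map, which commutes with the action.\<close>
  interpret invariant_mean T G \<phi> "\<lambda>A. m {e \<in> E. fst e \<in> A}"
  proof
    have "{e \<in> E. fst e \<in> V} = E" using arc_fst_in_verts by blast
    then show "m {e \<in> E. fst e \<in> V} = 1" using m(1) by simp
    show "0 \<le> m {e \<in> E. fst e \<in> A}" for A using m(2) .
    show "m {e \<in> E. fst e \<in> A \<union> B} = m {e \<in> E. fst e \<in> A} + m {e \<in> E. fst e \<in> B}"
      if "A \<inter> B = {}" for A B
    proof -
      have "{e \<in> E. fst e \<in> A \<union> B} = {e \<in> E. fst e \<in> A} \<union> {e \<in> E. fst e \<in> B}" by blast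
      then show ?thesis using m(3)[of "{e \<in> E. fst e \<in> A}" "{e \<in> E. fst e \<in> B}"] that by auto
    qed
    show "m {e \<in> E. fst e \<in> \<phi> g ` A} = m {e \<in> E. fst e \<in> A}" if g: "g \<in> carrier G" and A: "A \<subseteq> V" for g A
    proof -
      have "{e \<in> E. fst e \<in> \<phi> g ` A} = edge_action \<phi> g ` {e \<in> E. fst e \<in> A}"
      proof (intro equalityI subsetI)
        fix e assume e: "e \<in> {e \<in> E. fst e \<in> \<phi> g ` A}"
        then obtain f where f: "f \<in> E" "e = edge_action \<phi> g f"
          using bij_betw_imp_surj_on[OF perm.perm_bij[OF g]] by blast
        then have "\<phi> g (fst f) \<in> \<phi> g ` A" using e by (simp add: edge_action_def)
        then have "fst f \<in> A" using act_inj[OF g] A arc_fst_in_verts[OF f(1)] by blast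
        with f show "e \<in> edge_action \<phi> g ` {e \<in> E. fst e \<in> A}" by blast
      next
        fix e assume "e \<in> edge_action \<phi> g ` {e \<in> E. fst e \<in> A}"
        then obtain f where f: "f \<in> E" "fst f \<in> A" "e = edge_action \<phi> g f" by blast
        then show "e \<in> {e \<in> E. fst e \<in> \<phi> g ` A}"
          using perm.perm_closed[OF g f(1)] by (simp add: edge_action_def)
      qed
      then show ?thesis using m(4)[OF g, of "{e \<in> E. fst e \<in> A}"] by auto
    qed
  qed
  show ?thesis by (rule elementary)
qed

text \<open>Averages of \<open>ind\<close> over long windows of rays that \<open>G\<close> permutes up to cofinality are almost
  equivariant, because a shift of the window changes the sum only at its two boundaries.
  Constant sequences take the place of the rays when \<open>G\<close> has a finite orbit of vertices.\<close>

lemma trivial_if_permuted_rays: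
  fixes r :: "'i \<Rightarrow> nat \<Rightarrow> 'v" and \<sigma> :: "'g \<Rightarrow> 'i \<Rightarrow> 'i"
  assumes x: "x \<in> V" and I: "finite I" "I \<noteq> {}"
    and rV: "\<And>i n. i \<in> I \<Longrightarrow> r i n \<in> V"
    and rd: "\<And>i n k. i \<in> I \<Longrightarrow> vd (r i n) (r i (n + k)) \<le> k"
    and \<sigma>: "\<And>g. g \<in> carrier G \<Longrightarrow> bij_betw (\<sigma> g) I I"
    and shift: "\<And>g i. \<lbrakk>g \<in> carrier G; i \<in> I\<rbrakk> \<Longrightarrow> \<exists>m n. \<forall>k. \<phi> g (r i (m + k)) = r (\<sigma> g i) (n + k)"
  shows "haagerup_cocycle G T \<phi> x \<in> perm.closed_cob"
proof -
  let ?n = "ell2_norm E"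
  \<comment> \<open>In the coboundary, \<open>ind x\<close> yields the cocycle and the other terms
    an error. The window from \<open>N\<close> to \<open>2 * N - 1\<close> grows and eventually lies
    beyond all indices from which translated rays follow rays of the family.\<close>
  define u where "u N = (\<Sum>i\<in>I. \<Sum>k<N. ind x - ind (r i (N + k)))" for N :: nat
  define a where "a N = 1 / (real (card I) * real N)" for N :: nat
  define v where "v N = (\<lambda>e. complex_of_real (a N) * u N e)" for N
  have uE: "u N \<in> ell2 E" for N
    unfolding u_def by (intro ell2_sum ind_diff x rV)
  then have vE: "v N \<in> ell2 E" for N unfolding v_def by (rule ell2_scale)
  have lim: "\<forall>\<^sub>F N in sequentially. ?n (perm.\<pi> g (v N) - v N - haagerup_cocycle G T \<phi> x g) < \<epsilon>"
    if g: "g \<in> carrier G" and \<epsilon>: "\<epsilon> > 0" for g \<epsilon>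
  proof -
    let ?b = "ind (\<phi> g x) - ind x"
    have "\<forall>i\<in>I. \<exists>p. \<forall>k. \<phi> g (r i (fst p + k)) = r (\<sigma> g i) (snd p + k)"
      using shift[OF g] by fastforce
    then obtain p where p: "\<And>i k. i \<in> I \<Longrightarrow> \<phi> g (r i (fst (p i) + k)) = r (\<sigma> g i) (snd (p i) + k)"
      by metis
    define d where "d N i = (\<Sum>k<N. ind (r (\<sigma> g i) (N + k)) - ind (\<phi> g (r i (N + k))))" for N i
    \<comment> \<open>An upper bound for the displacement of the windows compared below, in either
      direction.\<close>
    define t where "t i = fst (p i) + snd (p i)" for i
    \<comment> \<open>Since \<open>\<sigma> g\<close> permutes \<open>I\<close>, the unmoved sum can
      be indexed by \<open>\<sigma> g i\<close>; each translated ray is then compared with the ray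
      that it finally follows.\<close>
    have diff: "perm.\<pi> g (u N) - u N = (\<Sum>i\<in>I. d N i) + (\<Sum>i\<in>I. \<Sum>k<N. ?b)" for N
    proof -
      have "(\<Sum>i\<in>I. \<Sum>k<N. ind (r i (N + k))) = (\<Sum>i\<in>I. \<Sum>k<N. ind (r (\<sigma> g i) (N + k)))"
        using sum.reindex_bij_betw[OF \<sigma>[OF g], of "\<lambda>i. \<Sum>k<N. ind (r i (N + k))"] by simp
      moreover have "perm.\<pi> g (u N) = (\<Sum>i\<in>I. \<Sum>k<N. ind (\<phi> g x) - ind (\<phi> g (r i (N + k))))"
        unfolding u_def perm.rep_sum perm.rep_diff using g x rV by (intro sum.cong refl) (simp add: rep_ind)
      ultimately show ?thesis
        unfolding u_def d_def sum_subtractf by (simp only: algebra_simps)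
    qed
    have dE: "d N i \<in> ell2 E \<and> ?n (d N i) \<le> real (t i) * sqrt (2 * real N)"
      if i: "i \<in> I" and N: "fst (p i) \<le> N" for N i
    proof -
      let ?j = "\<sigma> g i"
      have j: "?j \<in> I" using \<sigma>[OF g] i by (auto simp: bij_betw_def)
      \<comment> \<open>The translate of the ray with index \<open>i\<close>, read from
        \<open>N\<close>, is the ray with index \<open>?j\<close>, read from
        \<open>N'\<close>.\<close>
      define N' where "N' = snd (p i) + (N - fst (p i))"
      have "\<phi> g (r i (N + k)) = r ?j (N' + k)" for k
        using p[OF i, of "N - fst (p i) + k"] N by (simp add: N'_def add.assoc)
      then have d: "d N i = (\<Sum>k<N. ind (r ?j (N + k)) - ind (r ?j (N' + k)))"
        by (simp add: d_def)
      have close: "N \<le> N' \<Longrightarrow> N' - N \<le> t i" "N' \<le> N \<Longrightarrow> N - N' \<le> t i"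
        using N by (auto simp: N'_def t_def)
      have bound: "w \<in> ell2 E \<and> ?n w \<le> real (t i) * sqrt (2 * real N)"
        if "w = (\<Sum>k<N. ind (r ?j (L + k)) - ind (r ?j (L + (k + s))))" "s \<le> t i" for w L s
      proof -
        have "w \<in> ell2 E \<and> ?n w \<le> real s * sqrt (2 * real N)"
          unfolding that(1) using rV[OF j] rd[OF j, of "L + _"]
          by (intro shifted_average_norm[where s = "\<lambda>k. r ?j (L + k)"]) (auto simp: add.assoc)
        moreover have "real s * sqrt (2 * real N) \<le> real (t i) * sqrt (2 * real N)"
          using that(2) by (intro mult_right_mono) auto
        ultimately show ?thesis by linarith
      qed
      show ?thesis
      proof (cases "N \<le> N'")
        case True
        then have eq: "N' + k = N + (k + (N' - N))" for k by simp
        have "d N i = (\<Sum>k<N. ind (r ?j (N + k)) - ind (r ?j (N + (k + (N' - N)))))"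
          unfolding d by (simp only: eq)
        then show ?thesis using bound close True by blast
      next
        case False
        then have eq: "N + k = N' + (k + (N - N'))" for k by simp
        \<comment> \<open>\<open>shifted_average_norm\<close> treats forward shifts; a backward
          shift becomes one after a change of sign.\<close>
        have "- d N i = (\<Sum>k<N. ind (r ?j (N' + k)) - ind (r ?j (N' + (k + (N - N')))))"
          unfolding d by (simp only: sum_negf[symmetric] minus_diff_eq eq)
        then have "- d N i \<in> ell2 E \<and> ?n (- d N i) \<le> real (t i) * sqrt (2 * real N)"
          using bound close False by (meson nat_le_linear)
        then show ?thesis using ell2_uminus[of "- d N i" E] ell2_norm_uminus[of E "d N i"] by simp
      qed
    qed
    \<comment> \<open>Mean of the displacement bounds over the family; the total error is at most
      \<open>K * sqrt (2 * real N) / real N\<close>.\<close>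
    define K where "K = (\<Sum>i\<in>I. real (t i)) / real (card I)"
    have bound: "?n (perm.\<pi> g (v N) - v N - haagerup_cocycle G T \<phi> x g) \<le> K * sqrt (2 * real N) / real N"
      if N: "N > 0" "\<And>i. i \<in> I \<Longrightarrow> fst (p i) \<le> N" for N
    proof -
      have a: "a N * (real (card I) * real N) = 1" "a N \<ge> 0" using N I by (auto simp: a_def)
      have const: "(\<Sum>i\<in>I. \<Sum>k<N. ?b) e = of_real (real (card I) * real N) * ?b e" for e
        by (simp add: sum_fun_apply)
      have "perm.\<pi> g (v N) - v N - ?b = (\<lambda>e. complex_of_real (a N) * (\<Sum>i\<in>I. d N i) e)"
      proof
        fix e
        have "(perm.\<pi> g (v N) - v N - ?b) e = complex_of_real (a N) * (perm.\<pi> g (u N) - u N) e - ?b e"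
          by (simp add: v_def perm.rep_scale right_diff_distrib)
        also have "\<dots> = complex_of_real (a N) * (\<Sum>i\<in>I. d N i) e
            + complex_of_real (a N * (real (card I) * real N)) * ?b e - ?b e"
          unfolding diff plus_fun_apply const by (simp add: distrib_left mult.assoc)
        finally show "(perm.\<pi> g (v N) - v N - ?b) e = complex_of_real (a N) * (\<Sum>i\<in>I. d N i) e"
          unfolding a(1) by simp
      qed
      then have "?n (perm.\<pi> g (v N) - v N - ?b) = a N * ?n (\<Sum>i\<in>I. d N i)"
        using a(2) by (simp only: ell2_norm_scale norm_of_real abs_of_nonneg)
      also have "\<dots> \<le> a N * (\<Sum>i\<in>I. ?n (d N i))"
        using a(2) dE N by (intro mult_left_mono ell2_norm_sum) blast+
      also have "\<dots> \<le> a N * (\<Sum>i\<in>I. real (t i) * sqrt (2 * real N))"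
        using a(2) dE N by (intro mult_left_mono sum_mono) blast+
      also have "\<dots> = K * sqrt (2 * real N) / real N"
        by (simp add: a_def K_def sum_distrib_right)
      finally show ?thesis using g by (simp add: haagerup_cocycle_def)
    qed
    have "(\<lambda>N. K * sqrt (2 * real N) / real N) \<longlonglongrightarrow> 0" by real_asymp
    then have "\<forall>\<^sub>F N in sequentially. K * sqrt (2 * real N) / real N < \<epsilon>"
      using \<epsilon> by (rule order_tendstoD)
    moreover have "\<forall>\<^sub>F N in sequentially. N > 0 \<and> (\<forall>i\<in>I. fst (p i) \<le> N)"
      using I(1) by (intro eventually_conj eventually_gt_at_top eventually_ball_finite ballI eventually_ge_at_top)
    ultimately show ?thesis
    proof eventually_elim
      case (elim N)
      then show ?case by (intro le_less_trans[OF bound]) auto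
    qed
  qed
  show ?thesis
    unfolding perm.closed_cob_iff
  proof (intro conjI allI impI haagerup_cocycle x)
    fix S and \<epsilon> :: real assume S: "finite S \<and> S \<subseteq> carrier G \<and> 0 < \<epsilon>"
    then have "\<forall>\<^sub>F N in sequentially. \<forall>g\<in>S. ?n (perm.\<pi> g (v N) - v N - haagerup_cocycle G T \<phi> x g) < \<epsilon>"
      using lim by (intro eventually_ball_finite) auto
    then obtain N where "\<forall>g\<in>S. ?n (perm.\<pi> g (v N) - v N - haagerup_cocycle G T \<phi> x g) < \<epsilon>"
      using eventually_happens' by force
    then show "\<exists>v\<in>ell2 E. \<forall>g\<in>S. ?n (perm.\<pi> g v - v - haagerup_cocycle G T \<phi> x g) < \<epsilon>"
      using vE by blast
  qed
qed

lemma trivial_if_finite_orbit: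
  assumes x: "x \<in> V" and y: "y \<in> V" and fin: "finite (orbit G \<phi> y)"
  shows "haagerup_cocycle G T \<phi> x \<in> perm.closed_cob"
proof (rule trivial_if_permuted_rays[OF x fin, where r = "\<lambda>z n. z" and \<sigma> = \<phi>])
  have closed: "\<phi> g z \<in> orbit G \<phi> y" if g: "g \<in> carrier G" and z: "z \<in> orbit G \<phi> y" for g z
  proof -
    obtain h where h: "h \<in> carrier G" "z = \<phi> h y" using z by (auto simp: orbit_def)
    then have "\<phi> g z = \<phi> (g \<otimes> h) y" using composition_rule[OF y g h(1)] by simp
    then show ?thesis using g h unfolding orbit_def by blast
  qed
  show OV: "z \<in> V" if "z \<in> orbit G \<phi> y" for z n
    using that y by (auto simp: orbit_def)
  show "bij_betw (\<phi> g) (orbit G \<phi> y) (orbit G \<phi> y)" if g: "g \<in> carrier G" for g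
    using g closed OV act_inv act_inv' by (intro bij_betwI[where g = "\<phi> (inv g)"]) auto
  show "orbit G \<phi> y \<noteq> {}" using orbit_refl[OF y] by blast
qed auto

text \<open>One ray is chosen in each end of the orbit. The choice need not be equivariant, but the
  translate of a chosen ray and the ray chosen in the translated end lie in one class, and
  cofinality is exactly the shift hypothesis of \<open>trivial_if_permuted_rays\<close>.\<close>

lemma trivial_if_finite_end_orbit:
  assumes x: "x \<in> V" and \<xi>: "\<xi> \<in> ends T" and fin: "finite (orbit G (end_action \<phi>) \<xi>)"
  shows "haagerup_cocycle G T \<phi> x \<in> perm.closed_cob"
proof -
  obtain s where s: "s \<in> rays T" "\<xi> = cofinal_rel T `` {s}"
    using \<xi> unfolding ends_def by (rule quotientE) blast
  let ?O = "orbit G (end_action \<phi>) \<xi>"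
  have O: "?O = {cofinal_rel T `` {\<phi> g \<circ> s} | g. g \<in> carrier G}"
    using end_action_class[OF _ s(1)] unfolding orbit_def s(2) by blast
  define r where "r \<eta> = (SOME t. t \<in> \<eta>)" for \<eta> :: "(nat \<Rightarrow> 'v) set"
  have r: "r \<eta> \<in> rays T" "\<eta> = cofinal_rel T `` {r \<eta>}" if \<eta>: "\<eta> \<in> ?O" for \<eta>
  proof -
    obtain g where g: "g \<in> carrier G" "\<eta> = cofinal_rel T `` {\<phi> g \<circ> s}" using \<eta> O by auto
    have "\<phi> g \<circ> s \<in> \<eta>" using equiv_class_self[OF equiv_cofinal act_ray[OF g(1) s(1)]] g(2) by simp
    then have "r \<eta> \<in> \<eta>" unfolding r_def by (rule someI[of "\<lambda>t. t \<in> \<eta>"])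
    then have rel: "(\<phi> g \<circ> s, r \<eta>) \<in> cofinal_rel T" using g(2) by blast
    then show "r \<eta> \<in> rays T" by (simp add: cofinal_rel_def)
    show "\<eta> = cofinal_rel T `` {r \<eta>}" using equiv_class_eq[OF equiv_cofinal rel] g(2) by simp
  qed
  have act: "end_action \<phi> g \<eta> = cofinal_rel T `` {\<phi> g \<circ> r \<eta>}" if "g \<in> carrier G" "\<eta> \<in> ?O" for g \<eta>
    using end_action_class[OF that(1) r(1)[OF that(2)]] r(2)[OF that(2)] by simp
  have closed: "end_action \<phi> g \<eta> \<in> ?O" if g: "g \<in> carrier G" and \<eta>: "\<eta> \<in> ?O" for g \<eta>
  proof -
    obtain h where h: "h \<in> carrier G" "\<eta> = cofinal_rel T `` {\<phi> h \<circ> s}" using \<eta> O by auto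
    have "\<phi> g \<circ> (\<phi> h \<circ> s) = \<phi> (g \<otimes> h) \<circ> s"
      using composition_rule[OF ray_V[OF s(1)] g h(1)] by auto
    then have "end_action \<phi> g \<eta> = cofinal_rel T `` {\<phi> (g \<otimes> h) \<circ> s}"
      using end_action_class[OF g act_ray[OF h(1) s(1)]] h(2) by simp
    then show ?thesis using O g h by blast
  qed
  have undo: "end_action \<phi> g (end_action \<phi> (inv g) \<eta>) = \<eta>" if g: "g \<in> carrier G" and \<eta>: "\<eta> \<in> ?O" for g \<eta>
    using act[OF inv_closed[OF g] \<eta>] end_action_class[OF g act_ray[OF inv_closed[OF g] r(1)[OF \<eta>]]]
      act_ray_inv[OF g r(1)[OF \<eta>]] r(2)[OF \<eta>] by simp
  show ?thesis
  proof (rule trivial_if_permuted_rays[OF x fin, where r = r and \<sigma> = "end_action \<phi>"])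
    show "?O \<noteq> {}" using O one_closed by blast
    show "r \<eta> n \<in> V" if "\<eta> \<in> ?O" for \<eta> n using ray_V r(1) that by blast
    show "vd (r \<eta> n) (r \<eta> (n + k)) \<le> k" if "\<eta> \<in> ?O" for \<eta> n k using ray_vd r(1) that by simp
    show "bij_betw (end_action \<phi> g) ?O ?O" if g: "g \<in> carrier G" for g
    proof (rule bij_betwI[where g = "end_action \<phi> (inv g)"])
      show "end_action \<phi> (inv g) (end_action \<phi> g \<eta>) = \<eta>" if "\<eta> \<in> ?O" for \<eta>
        using undo[of "inv g" \<eta>] g that by simp
    qed (use g closed undo in auto)
    show "\<exists>m n. \<forall>k. \<phi> g (r \<eta> (m + k)) = r (end_action \<phi> g \<eta>) (n + k)"
      if g: "g \<in> carrier G" and \<eta>: "\<eta> \<in> ?O" for g \<eta>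
    proof -
      have "r (end_action \<phi> g \<eta>) \<in> end_action \<phi> g \<eta>"
        using equiv_class_self[OF equiv_cofinal] r[OF closed[OF g \<eta>]] by blast
      then have "(\<phi> g \<circ> r \<eta>, r (end_action \<phi> g \<eta>)) \<in> cofinal_rel T" using act[OF g \<eta>] by blast
      then show ?thesis by (auto simp: cofinal_rel_def)
    qed
  qed
qed

end

theorem theorem12:
  fixes G :: "('g, 'c) monoid_scheme"
    and T :: "'v pair_pre_digraph"
    and \<phi> :: "'g \<Rightarrow> 'v \<Rightarrow> 'v"
    and x\<^sub>0 :: 'v
  assumes "is_tree T"
    and "group G"
    and "tree_action G T \<phi>"
    and "without_inversion G T \<phi>"
    and "x\<^sub>0 \<in> pverts T"
  shows "(let M = ell2 (parcs T);
              X = ell2_topology (parcs T);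
              \<pi> = perm_rep G (parcs T) (edge_action \<phi>)
          in reduced_class G M X \<pi> (haagerup_cocycle G T \<phi> x\<^sub>0) = \<one>\<^bsub>reduced_H1 G M X \<pi>\<^esub>)
         \<longleftrightarrow> elementary_action G T \<phi>"
proof -
  interpret acting_on_tree T G \<phi>
    using assms by (intro acting_on_tree.intro tree_graph.intro acting_on_tree_axioms.intro)
  have "haagerup_cocycle G T \<phi> x\<^sub>0 \<in> perm.closed_cob \<longleftrightarrow> elementary_action G T \<phi>"
    using elementary_if_trivial trivial_if_finite_orbit trivial_if_finite_end_orbit assms(5)
    unfolding elementary_action_def by blast
  then show ?thesis
    unfolding Let_def using perm.reduced_class_trivial_iff[OF haagerup_cocycle[OF assms(5)]] by simp
qed

end
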